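(* For each integer $u\ge 1$ the limit $\mu_u=\lim_{n\to\infty}E\big[(lk(L_n)/n)^u\big]$ exists, there is a unique probability distribution on $\mathbb{R}$ with moments $\mu_u$ ($u\ge1$), and the distribution of the normalized linking number $\frac{lk(L_n)}{n}$ converges weakly to this distribution as $n\to\infty$.
   Context: For a positive integer $n$ and permutations $\sigma,\pi\in S_{2n}$, write $\sigma=(x_1,\dots,x_n,x'_1,\dots,x'_n)$ and $\pi=(y_1,\dots,y_n,y'_1,\dots,y'_n)$ in one-line notation (so $x_k=\sigma(k)$, $x'_l=\sigma(n+l)$, $y_k=\pi(k)$, $y'_l=\pi(n+l)$), the indices $k,l\in\{1,\dots,n\}$ being read modulo $n$. The 2-component oriented grid link diagram $L_n^{\sigma,\pi}$ of order $2n$ has as first component the closed polygonal path $(x_1,y_1)\to(x_1,y_2)\to(x_2,y_2)\to(x_2,y_3)\to\cdots\to(x_n,y_n)\to(x_n,y_1)\to(x_1,y_1)$ and as second component the closed polygonal path $(x'_1,y'_1)\to(x'_1,y'_2)\to(x'_2,y'_2)\to\cdots\to(x'_n,y'_n)\to(x'_n,y'_1)\to(x'_1,y'_1)$; vertical edges always cross over horizontal edges. The linking number of an oriented 2-component link diagram is the sum of the crossing signs over all crossings at which the first component crosses under the second. For $L_n^{\sigma,\pi}$ this is $lk(L_n^{\sigma,\pi})=\sum_{k=1}^n\sum_{l=1}^n\varepsilon_{k,l}^{\sigma,\pi}$, where $\varepsilon_{k,l}^{\sigma,\pi}=+1$ if ($x_k<x'_l<x_{k+1}$ and $y'_{l+1}<y_{k+1}<y'_l$)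 or ($x_{k+1}<x'_l<x_k$ and $y'_l<y_{k+1}<y'_{l+1}$); $\varepsilon_{k,l}^{\sigma,\pi}=-1$ if ($x_k<x'_l<x_{k+1}$ and $y'_l<y_{k+1}<y'_{l+1}$) or ($x_{k+1}<x'_l<x_k$ and $y'_{l+1}<y_{k+1}<y'_l$); and $\varepsilon_{k,l}^{\sigma,\pi}=0$ otherwise. The random link $L_n$ in the grid model is $L_n^{\sigma,\pi}$ with $\sigma,\pi\in S_{2n}$ chosen independently and uniformly at random; $lk(L_n)$ is the resulting random variable and $E$ denotes expectation. A sequence of random variables $X_n$ converges weakly to a distribution with distribution function $F$ if $P(X_n\le y)\to F(y)$ at every continuity point $y$ of $F$. *)

theory Defs
  imports "HOL-Probability.Probability" "HOL-Combinatorics.Combinatorics"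
begin

type_synonym point = "int \<times> int"

text \<open>An oriented edge is a pair (start, end); a component of an oriented grid link diagram is
  given by its oriented edges, and a 2-component diagram by the pair of its components.\<close>

type_synonym edge = "point \<times> point"
type_synonym diagram2 = "edge set \<times> edge set"

text \<open>Vertical edges always pass over horizontal ones, so an edge \<open>e\<close> crosses under an
  edge \<open>f\<close> iff \<open>e\<close> is horizontal, \<open>f\<close> is vertical and they meet in a
  point interior to both.\<close>

fun crosses_under :: "edge \<Rightarrow> edge \<Rightarrow> bool" where
  "crosses_under ((a, b), (c, d)) ((a', b'), (c', d')) \<longleftrightarrow>
     b = d \<and> a' = c' \<and>
     min a c < a' \<and> a' < max a c \<and>
     min b' d' < b \<and> b < max b' d'"

text \<open>The usual sign convention: a crossing is positive iff the direction of the under-strand lies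
  counterclockwise from that of the over-strand, i.e. iff \<open>det (over, under) > 0\<close>.\<close>

fun crossing_sign :: "edge \<Rightarrow> edge \<Rightarrow> int" where
  "crossing_sign ((a, b), (c, d)) ((a', b'), (c', d')) =
     sgn ((c' - a') * (d - b) - (d' - b') * (c - a))"

text \<open>In \<^term>\<open>crossing_sign e f\<close> the edge \<open>e\<close> is the under-strand, as in
  \<^term>\<open>crosses_under e f\<close>.\<close>

definition linking_number :: "diagram2 \<Rightarrow> int" where
  "linking_number D =
     (\<Sum>(e, f) \<in> {(e, f). e \<in> fst D \<and> f \<in> snd D \<and> crosses_under e f}. crossing_sign e f)"

text \<open>Cyclic successor on the index set \<open>{1..n}\<close>.\<close>

definition cyc_suc :: "nat \<Rightarrow> nat \<Rightarrow> nat" where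
  "cyc_suc n k = k mod n + 1"

definition grid_component :: "nat \<Rightarrow> (nat \<Rightarrow> nat) \<Rightarrow> (nat \<Rightarrow> nat) \<Rightarrow> edge set" where
  "grid_component n x y =
     (\<Union>k\<in>{1..n}.
        {((int (x k), int (y k)), (int (x k), int (y (cyc_suc n k)))),
         ((int (x k), int (y (cyc_suc n k))), (int (x (cyc_suc n k)), int (y (cyc_suc n k))))})"

definition grid_link :: "nat \<Rightarrow> (nat \<Rightarrow> nat) \<Rightarrow> (nat \<Rightarrow> nat) \<Rightarrow> diagram2" where
  "grid_link n \<sigma> \<pi> =
     (grid_component n \<sigma> \<pi>,
      grid_component n (\<lambda>k. \<sigma> (n + k)) (\<lambda>k. \<pi> (n + k)))"

definition random_grid_pair :: "nat \<Rightarrow> ((nat \<Rightarrow> nat) \<times> (nat \<Rightarrow> nat)) pmf" where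
  "random_grid_pair n =
     pair_pmf (pmf_of_set {\<sigma>. \<sigma> permutes {1..2 * n}}) (pmf_of_set {\<pi>. \<pi> permutes {1..2 * n}})"

text \<open>The normalized linking number. Only the values for \<open>n > 0\<close> are meaningful; the
  value at \<open>n = 0\<close> has no influence on limits.\<close>

definition normalized_lk :: "nat \<Rightarrow> (nat \<Rightarrow> nat) \<times> (nat \<Rightarrow> nat) \<Rightarrow> real" where
  "normalized_lk n = (\<lambda>(\<sigma>, \<pi>). real_of_int (linking_number (grid_link n \<sigma> \<pi>)) / real n)"

definition has_moments :: "real measure \<Rightarrow> (nat \<Rightarrow> real) \<Rightarrow> bool" where
  "has_moments M \<mu> \<longleftrightarrow> (\<forall>u\<ge>1. has_bochner_integral M (\<lambda>x. x ^ u) (\<mu> u))"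

text \<open>The linking number of a grid link in coordinates.\<close>

definition grid_eps :: "nat \<Rightarrow> (nat \<Rightarrow> nat) \<Rightarrow> (nat \<Rightarrow> nat) \<Rightarrow> nat \<Rightarrow> nat \<Rightarrow> int" where
  "grid_eps n \<sigma> \<pi> k l =
     (let x = \<sigma> k; x1 = \<sigma> (cyc_suc n k); x' = \<sigma> (n + l);
          y1 = \<pi> (cyc_suc n k); y' = \<pi> (n + l); y1' = \<pi> (n + cyc_suc n l)
      in if (x < x' \<and> x' < x1 \<and> y1' < y1 \<and> y1 < y') \<or>
            (x1 < x' \<and> x' < x \<and> y' < y1 \<and> y1 < y1') then 1
         else if (x < x' \<and> x' < x1 \<and> y' < y1 \<and> y1 < y1') \<or>
            (x1 < x' \<and> x' < x \<and> y1' < y1 \<and> y1 < y') then -1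
         else 0)"

lemma linking_number_grid_link:
  assumes \<sigma>: "\<sigma> permutes {1..2 * n}"
  shows "linking_number (grid_link n \<sigma> \<pi>) = (\<Sum>k=1..n. \<Sum>l=1..n. grid_eps n \<sigma> \<pi> k l)"
proof -
  define h where "h k = ((int (\<sigma> k), int (\<pi> (cyc_suc n k))),
    (int (\<sigma> (cyc_suc n k)), int (\<pi> (cyc_suc n k))))" for k
  define v where "v l = ((int (\<sigma> (n + l)), int (\<pi> (n + l))),
    (int (\<sigma> (n + l)), int (\<pi> (n + cyc_suc n l))))" for l
  define C where "C = {(k, l). k \<in> {1..n} \<and> l \<in> {1..n} \<and> crosses_under (h k) (v l)}"
  let ?D = "grid_link n \<sigma> \<pi>"
  have inj: "inj \<sigma>" using \<sigma> by (rule permutes_inj)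
  have img: "{(e, f). e \<in> fst ?D \<and> f \<in> snd ?D \<and> crosses_under e f} = (\<lambda>(k, l). (h k, v l)) ` C"
    (is "?L = ?R")
  proof
    show "?L \<subseteq> ?R"
    proof
      fix p assume "p \<in> ?L"
      then obtain e f where p: "p = (e, f)" and e: "e \<in> fst ?D" and f: "f \<in> snd ?D"
        and cr: "crosses_under e f"
        by auto
      obtain k where k: "k \<in> {1..n}" "e = h k"
        using e cr by (cases f) (auto simp: grid_link_def grid_component_def h_def)
      obtain l where l: "l \<in> {1..n}" "f = v l"
        using f cr by (cases e) (auto simp: grid_link_def grid_component_def v_def)
      have "(k, l) \<in> C" using k l cr by (simp add: C_def)
      then show "p \<in> ?R" using p k l by force
    qed
  next
    show "?R \<subseteq> ?L"
    proof
      fix p assume "p \<in> ?R"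
      then obtain k l where p: "p = (h k, v l)" and k: "k \<in> {1..n}" and l: "l \<in> {1..n}"
        and cr: "crosses_under (h k) (v l)"
        by (auto simp: C_def)
      have "h k \<in> fst ?D"
        using k unfolding grid_link_def grid_component_def h_def by auto
      moreover have "v l \<in> snd ?D"
        using l unfolding grid_link_def grid_component_def v_def by auto
      ultimately show "p \<in> ?L" using p cr by simp
    qed
  qed
  have injC: "inj_on (\<lambda>(k, l). (h k, v l)) C"
    by (auto simp: inj_on_def h_def v_def inj_eq[OF inj])
  have eps: "grid_eps n \<sigma> \<pi> k l =
      (if crosses_under (h k) (v l) then crossing_sign (h k) (v l) else 0)" for k l
    by (auto simp: grid_eps_def h_def v_def Let_def mult_less_0_iff zero_less_mult_iff min_def max_def sgn_if
        split: if_splits)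
  have "linking_number ?D = (\<Sum>(k, l)\<in>C. crossing_sign (h k) (v l))"
    unfolding linking_number_def img
    by (subst sum.reindex[OF injC]) (simp add: case_prod_unfold)
  also have "\<dots> = (\<Sum>(k, l)\<in>{1..n} \<times> {1..n}. grid_eps n \<sigma> \<pi> k l)"
    unfolding eps
    by (rule sum.mono_neutral_cong_left) (auto simp: C_def split: if_split_asm)
  also have "\<dots> = (\<Sum>k=1..n. \<Sum>l=1..n. grid_eps n \<sigma> \<pi> k l)"
    by (simp add: sum.cartesian_product)
  finally show ?thesis .
qed

end

theory Submission
  imports Defs
begin

text \<open>The linking number is minus a double sum over \<open>k, l\<close> of a product of two differences of
  order indicators, one depending only on \<open>\<sigma>\<close> and one only on \<open>\<pi>\<close>. Expanding its \<open>u\<close>-th power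
  gives a sum over pairs \<open>f, g\<close> of \<open>u\<close>-tuples of indices. Swapping two values of a permutation shows
  that a term vanishes on average if some \<open>f i\<close> or some \<open>g i\<close> is isolated, that is, not cyclically
  within distance 1 of another entry of the tuple. So the tuples that matter have at most \<open>u / 2\<close> clusters,
  whence there are \<open>O(n^(u/2))\<close> of them. The average of a term depends only on which
  entries coincide or are cyclic successors of each other, and the number of tuples with a given such
  pattern is asymptotic to a constant times \<open>n^(u/2)\<close>: only the patterns whose clusters are all
  pairs survive. This gives the limits \<open>\<mu> u\<close> together with a bound \<open>C^u u!\<close>.
  Moments of this size determine the distribution, because its characteristic function is then given
  locally, around each point, by a power series with a uniform radius of convergence; weak convergence
  follows by tightness.\<close>

section \<open>The method of moments\<close>

text \<open>Expand \<open>iexp (s * x)\<close> and integrate termwise. Since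
  \<open>fact (k + j) \<le> 2 ^ (k + j) * (fact k * fact j)\<close>, the integrals of the norms are
  dominated by a geometric series of ratio \<open>2 * B * \<bar>s\<bar>\<close>, a radius
  independent of \<open>t\<close> and \<open>k\<close>. With the weight \<open>x ^ k\<close> the
  right side involves only integrals of the same kind at \<open>t\<close>, so the step can be
  iterated.\<close>

lemma iexp_moment_series:
  fixes M :: "real measure"
  assumes M: "real_distribution M"
    and int: "\<And>k. integrable M (\<lambda>x. x ^ k)"
    and bound: "\<And>k. (\<integral>x. \<bar>x\<bar> ^ k \<partial>M) \<le> B ^ k * fact k"
    and s: "2 * B * \<bar>s\<bar> < 1" and B: "B \<ge> 0"
  shows "(\<integral>x. of_real (x ^ k) * iexp ((t + s) * x) \<partial>M) =
    (\<Sum>j. (\<i> * of_real s) ^ j / fact j * (\<integral>x. of_real (x ^ (k + j)) * iexp (t * x) \<partial>M))"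
proof -
  interpret real_distribution M by fact
  have int': "integrable M (\<lambda>x. of_real (x ^ m) * iexp (t * x))" for m
    by (rule Bochner_Integration.integrable_bound[OF int[of m]]) (auto simp: norm_mult norm_power power_abs)
  define h where "h j x = (\<i> * of_real s) ^ j / fact j * (of_real (x ^ (k + j)) * iexp (t * x))" for j x
  have norm_h: "norm (h j x) = \<bar>s\<bar> ^ j / fact j * \<bar>x\<bar> ^ (k + j)" for j x
    by (simp add: h_def norm_mult norm_divide norm_power power_abs)
  have h_sums: "(\<lambda>j. h j x) sums (of_real (x ^ k) * iexp ((t + s) * x))" for x
  proof -
    have "(\<lambda>j. (\<i> * of_real (s * x)) ^ j /\<^sub>R fact j) sums exp (\<i> * of_real (s * x))"
      by (rule exp_converges)
    from sums_mult[OF this, of "of_real (x ^ k) * iexp (t * x)"]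
    have "(\<lambda>j. of_real (x ^ k) * iexp (t * x) * ((\<i> * of_real (s * x)) ^ j /\<^sub>R fact j)) sums
        (of_real (x ^ k) * iexp (t * x) * exp (\<i> * of_real (s * x)))" .
    moreover have "of_real (x ^ k) * iexp (t * x) * ((\<i> * of_real (s * x)) ^ j /\<^sub>R fact j) = h j x" for j
      by (simp add: h_def scaleR_conv_of_real power_add power_mult_distrib field_simps)
    moreover have "of_real (x ^ k) * iexp (t * x) * exp (\<i> * of_real (s * x)) =
        of_real (x ^ k) * iexp ((t + s) * x)"
      by (simp add: mult.assoc flip: exp_add) (simp add: algebra_simps)
    ultimately show ?thesis by (simp only:)
  qed
  have h_int: "integrable M (h j)" for j
    unfolding h_def by (intro integrable_mult_right int')
  have "summable (\<lambda>j. \<integral>x. norm (h j x) \<partial>M)"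
  proof (rule summable_comparison_test')
    show "summable (\<lambda>j. (2 * B) ^ k * fact k * (2 * B * \<bar>s\<bar>) ^ j)"
      using s B by (intro summable_mult summable_geometric) auto
  next
    fix j :: nat
    have "(\<integral>x. norm (h j x) \<partial>M) = \<bar>s\<bar> ^ j / fact j * (\<integral>x. \<bar>x\<bar> ^ (k + j) \<partial>M)"
      unfolding norm_h by simp
    also have "\<dots> \<le> \<bar>s\<bar> ^ j / fact j * (B ^ (k + j) * fact (k + j))"
      by (intro mult_left_mono bound) auto
    also have "\<dots> \<le> \<bar>s\<bar> ^ j / fact j * (B ^ (k + j) * (2 ^ (k + j) * (fact k * fact j)))"
    proof -
      have "fact (k + j) = fact k * fact j * ((k + j) choose k)"
        using binomial_fact_lemma[of k "k + j"] by simp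
      also have "\<dots> \<le> fact k * fact j * 2 ^ (k + j)"
        by (intro mult_left_mono binomial_le_pow2) auto
      finally have "real (fact (k + j)) \<le> real (fact k * fact j * 2 ^ (k + j))"
        by (rule of_nat_mono)
      then show ?thesis
        using B by (intro mult_left_mono) (auto simp: algebra_simps)
    qed
    also have "\<dots> = (2 * B) ^ k * fact k * (2 * B * \<bar>s\<bar>) ^ j"
      by (simp add: power_add power_mult_distrib)
    finally show "norm (\<integral>x. norm (h j x) \<partial>M) \<le> (2 * B) ^ k * fact k * (2 * B * \<bar>s\<bar>) ^ j"
      by simp
  qed
  moreover have "AE x in M. summable (\<lambda>j. norm (h j x))"
  proof (rule AE_I2)
    fix x
    have "summable (\<lambda>j. \<bar>x\<bar> ^ k * ((\<bar>s\<bar> * \<bar>x\<bar>) ^ j /\<^sub>R fact j))"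
      by (intro summable_mult summable_exp_generic)
    moreover have "\<bar>x\<bar> ^ k * ((\<bar>s\<bar> * \<bar>x\<bar>) ^ j /\<^sub>R fact j) = norm (h j x)" for j
      unfolding norm_h by (simp add: power_add power_mult_distrib field_simps)
    ultimately show "summable (\<lambda>j. norm (h j x))" by (simp only:)
  qed
  ultimately have "(\<integral>x. (\<Sum>j. h j x) \<partial>M) = (\<Sum>j. \<integral>x. h j x \<partial>M)"
    by (intro integral_suminf h_int)
  moreover have "(\<Sum>j. h j x) = of_real (x ^ k) * iexp ((t + s) * x)" for x
    using h_sums by (rule sums_unique[symmetric])
  moreover have "(\<integral>x. h j x \<partial>M) =
      (\<i> * of_real s) ^ j / fact j * (\<integral>x. of_real (x ^ (k + j)) * iexp (t * x) \<partial>M)" for j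
    unfolding h_def by simp
  ultimately show ?thesis by simp
qed

text \<open>The series carries agreement of the weighted integrals, for all \<open>k\<close> at
  once, from \<open>t\<close> to \<open>t + s\<close>. Finitely many short steps from 0 reach any
  point, so the characteristic functions agree.\<close>

lemma real_distribution_eqI_moments:
  fixes M N :: "real measure"
  assumes M: "real_distribution M" and N: "real_distribution N"
    and intM: "\<And>k. integrable M (\<lambda>x. x ^ k)" and intN: "\<And>k. integrable N (\<lambda>x. x ^ k)"
    and boundM: "\<And>k. (\<integral>x. \<bar>x\<bar> ^ k \<partial>M) \<le> B ^ k * fact k"
    and boundN: "\<And>k. (\<integral>x. \<bar>x\<bar> ^ k \<partial>N) \<le> B ^ k * fact k"
    and eq: "\<And>k. (\<integral>x. x ^ k \<partial>M) = (\<integral>x. x ^ k \<partial>N)"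
    and B: "B \<ge> 0"
  shows "M = N"
proof (rule Levy_uniqueness[OF M N], rule ext)
  define \<phi> where "\<phi> L k t = (\<integral>x. of_real (x ^ k) * iexp (t * x) \<partial>(L :: real measure))" for L and k :: nat and t
  have step: "\<forall>k. \<phi> M k (t + s) = \<phi> N k (t + s)"
    if "\<forall>k. \<phi> M k t = \<phi> N k t" "2 * B * \<bar>s\<bar> < 1" for s t
    using that(1) unfolding \<phi>_def
      iexp_moment_series[OF M intM boundM that(2) B] iexp_moment_series[OF N intN boundN that(2) B]
    by simp
  fix t :: real
  \<comment> \<open>Enough steps of size \<open>t / m\<close> to stay inside the radius of
    convergence.\<close>
  obtain m :: nat where m: "m > 2 * B * \<bar>t\<bar>" "m > 0"
    by (metis gr0I reals_Archimedean2 of_nat_0 abs_ge_zero B mult_nonneg_nonneg not_less zero_le_numeral)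
  have "\<forall>k. \<phi> M k (of_nat j * (t / m)) = \<phi> N k (of_nat j * (t / m))" for j
  proof (induction j)
    case 0
    \<comment> \<open>At 0 the weighted integrals are the moments themselves.\<close>
    have "\<phi> L k 0 = complex_of_real (\<integral>x. x ^ k \<partial>L)" for L k
      by (simp add: \<phi>_def flip: of_real_power)
    with eq show ?case by simp
  next
    case (Suc j)
    have "2 * B * \<bar>t / m\<bar> < 1" using m by (simp add: field_simps)
    from step[OF Suc this] show ?case by (simp add: algebra_simps add_divide_distrib)
  qed
  from this[of m] have "\<phi> M 0 t = \<phi> N 0 t" using m by simp
  then show "char M t = char N t" by (simp add: \<phi>_def char_def)
qed

text \<open>Absolute moments are reached through even ones:
  \<open>\<bar>x\<bar> ^ k \<le> x ^ (2 * k) / (2 * L) + L / 2\<close>, by completing a square. The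
  factor 2 in \<open>2 * C\<close> pays for
  \<open>fact (2 * k) \<le> 4 ^ k * (fact k * fact k)\<close>.\<close>

lemma absolute_moment_bound:
  fixes M :: "real measure"
  assumes M: "real_distribution M" and int: "\<And>k. integrable M (\<lambda>x. x ^ k)"
    and bound: "\<And>k. (\<integral>x. x ^ k \<partial>M) \<le> C ^ k * fact k" and C: "C > 0"
  shows "(\<integral>x. \<bar>x\<bar> ^ k \<partial>M) \<le> (2 * C) ^ k * fact k"
proof -
  interpret real_distribution M by fact
  \<comment> \<open>The target bound itself: \<open>L * L\<close> dominates the moment of order
    \<open>2 * k\<close>, so both summands contribute at most \<open>L / 2\<close>.\<close>
  define L where "L = (2 * C) ^ k * (fact k :: real)"
  have L: "L > 0" using C by (simp add: L_def)
  have int_abs: "integrable M (\<lambda>x. \<bar>x\<bar> ^ k)"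
    using integrable_abs[OF int[of k]] by (simp add: power_abs)
  have "(\<integral>x. \<bar>x\<bar> ^ k \<partial>M) \<le> (\<integral>x. x ^ (2 * k) / (2 * L) + L / 2 \<partial>M)"
  proof (rule integral_mono[OF int_abs])
    show "integrable M (\<lambda>x. x ^ (2 * k) / (2 * L) + L / 2)"
      using int by simp
    fix x :: real
    have "0 \<le> (\<bar>x\<bar> ^ k - L)\<^sup>2" by simp
    also have "\<dots> = x ^ (2 * k) - 2 * L * \<bar>x\<bar> ^ k + L * L"
      by (simp add: power2_eq_square algebra_simps flip: power_add mult_2)
         (simp add: mult.commute power_even_abs)
    finally show "\<bar>x\<bar> ^ k \<le> x ^ (2 * k) / (2 * L) + L / 2"
      using L by (simp add: field_simps)
  qed
  also have "\<dots> = (\<integral>x. x ^ (2 * k) \<partial>M) / (2 * L) + L / 2"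
    using int prob_space by simp
  also have "\<dots> \<le> L * L / (2 * L) + L / 2"
  proof (intro add_right_mono divide_right_mono)
    have "(\<integral>x. x ^ (2 * k) \<partial>M) \<le> C ^ (2 * k) * fact (2 * k)" by (rule bound)
    also have "\<dots> \<le> C ^ (2 * k) * (4 ^ k * (fact k * fact k))"
    proof (rule mult_left_mono)
      have "fact (2 * k) = fact k * fact k * ((2 * k) choose k)"
        using binomial_fact_lemma[of k "2 * k"] by simp
      also have "\<dots> \<le> fact k * fact k * 2 ^ (2 * k)"
        by (intro mult_left_mono binomial_le_pow2) auto
      finally have "real (fact (2 * k)) \<le> real (fact k * fact k * 2 ^ (2 * k))"
        by (rule of_nat_mono)
      then show "fact (2 * k) \<le> 4 ^ k * (fact k * fact k :: real)"
        by (simp only: power_mult of_nat_mult of_nat_power of_nat_numeral of_nat_fact) (simp add: mult.commute)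
    qed (use C in simp)
    also have "\<dots> = L * L"
      by (simp add: L_def power_mult power_mult_distrib power2_eq_square)
        (simp flip: power_mult_distrib)
    finally show "(\<integral>x. x ^ (2 * k) \<partial>M) \<le> L * L" .
  qed (use L in simp)
  also have "\<dots> = L" using L by simp
  finally show ?thesis by (simp add: L_def)
qed

section \<open>Passing moments to a weak limit by truncation\<close>

text \<open>A bounded continuous substitute for \<open>x ^ u\<close>, to which weak convergence
  applies.\<close>

definition clamp_power :: "real \<Rightarrow> nat \<Rightarrow> real \<Rightarrow> real" where
  "clamp_power K u x = (max (- K) (min K x)) ^ u"

lemma isCont_clamp_power: "isCont (clamp_power K u) x"
  unfolding clamp_power_def by (intro continuous_intros)

lemma clamp_power_bound: "K \<ge> 0 \<Longrightarrow> norm (clamp_power K u x) \<le> K ^ u"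
  unfolding clamp_power_def by (auto simp: power_abs intro!: power_mono)

lemma clamp_power_le: "K \<ge> 0 \<Longrightarrow> norm (clamp_power K u x) \<le> \<bar>x\<bar> ^ u"
  unfolding clamp_power_def by (auto simp: power_abs intro!: power_mono)

text \<open>Beyond \<open>K\<close> one has \<open>1 \<le> \<bar>x\<bar> ^ u / K ^ u\<close>, so the
  tail of order \<open>u\<close> is paid for by the moment of order \<open>2 * u\<close>.\<close>

lemma clamp_power_error:
  assumes "K > 0"
  shows "\<bar>x ^ u - clamp_power K u x\<bar> \<le> 2 * x ^ (2 * u) / K ^ u"
proof (cases "\<bar>x\<bar> \<le> K")
  case True
  then have "clamp_power K u x = x ^ u" by (simp add: clamp_power_def)
  with assms show ?thesis by simp
next
  case False
  have "\<bar>x ^ u - clamp_power K u x\<bar> \<le> \<bar>x\<bar> ^ u + \<bar>x\<bar> ^ u"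
    using clamp_power_le[of K u x] assms abs_triangle_ineq4[of "x ^ u" "clamp_power K u x"]
    by (simp add: power_abs)
  also have "\<dots> = 2 * \<bar>x\<bar> ^ u * 1" by simp
  also have "\<dots> \<le> 2 * \<bar>x\<bar> ^ u * (\<bar>x\<bar> ^ u / K ^ u)"
    using False assms by (intro mult_left_mono) (auto intro!: power_mono)
  also have "\<dots> = 2 * x ^ (2 * u) / K ^ u"
    by (simp add: power_mult flip: power2_eq_square)
      (simp add: power2_eq_square power_mult_distrib[symmetric])
  finally show ?thesis .
qed

text \<open>Weak convergence handles the truncated powers. The truncation error is controlled by the
  moment of order \<open>2 * u\<close> over \<open>K ^ u\<close>, both along the sequence and for
  the limit, whose even moments are bounded first. Then \<open>K\<close> tends to infinity.\<close>

lemma moments_weak_limit: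
  fixes \<nu> :: "nat \<Rightarrow> real measure"
  assumes \<nu>: "\<And>n. real_distribution (\<nu> n)" and M: "real_distribution M"
    and weak: "weak_conv_m \<nu> M"
    and int: "\<And>n k. integrable (\<nu> n) (\<lambda>x. x ^ k)"
    and lim: "\<And>k. (\<lambda>n. \<integral>x. x ^ k \<partial>\<nu> n) \<longlonglongrightarrow> m k"
  shows "has_bochner_integral M (\<lambda>x. x ^ u) (m u)"
proof -
  interpret M: real_distribution M by fact
  have conv: "(\<lambda>n. integral\<^sup>L (\<nu> n) (clamp_power K k)) \<longlonglongrightarrow> integral\<^sup>L M (clamp_power K k)"
    if "K \<ge> 0" for K k
    by (rule weak_conv_imp_integral_bdd_continuous_conv[OF \<nu> M weak isCont_clamp_power clamp_power_bound[OF that]])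
  have cl_meas[measurable]: "clamp_power K k \<in> borel_measurable borel" for K k
    unfolding clamp_power_def by measurable
  have cl_int: "integrable L (clamp_power K k)" if "real_distribution L" "K \<ge> 0" for L K k
  proof -
    interpret L: real_distribution L by fact
    show ?thesis
      by (rule L.integrable_const_bound[of _ "K ^ k"])
        (use clamp_power_bound[OF that(2)] in auto)
  qed
  have even_clamp: "0 \<le> clamp_power K (2 * k) x" "clamp_power K (2 * k) x \<le> x ^ (2 * k)" if "K \<ge> 0" for K k x
    using clamp_power_le[OF that, of "2 * k" x]
    by (auto simp: clamp_power_def power_mult)
  have even_le: "integral\<^sup>L M (clamp_power K (2 * k)) \<le> m (2 * k)" if "K \<ge> 0" for K k
    by (rule LIMSEQ_le[OF conv[OF that] lim])
      (auto intro!: exI[of _ 0] integral_mono cl_int int \<nu> even_clamp that)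
  \<comment> \<open>Fatou's lemma, as the truncation level runs through the naturals.\<close>
  have even_nn: "(\<integral>\<^sup>+x. ennreal (x ^ (2 * k)) \<partial>M) \<le> ennreal (m (2 * k))" for k
  proof -
    have "(\<integral>\<^sup>+x. ennreal (x ^ (2 * k)) \<partial>M) =
        (\<integral>\<^sup>+x. liminf (\<lambda>j. ennreal (clamp_power (real j) (2 * k) x)) \<partial>M)"
    proof (rule nn_integral_cong)
      fix x :: real
      obtain N :: nat where N: "\<bar>x\<bar> < N" using reals_Archimedean2 by blast
      have "eventually (\<lambda>j. clamp_power (real j) (2 * k) x = x ^ (2 * k)) sequentially"
        using eventually_ge_at_top[of N]
        by eventually_elim (use N in \<open>auto simp: clamp_power_def min_def max_def\<close>)
      then have "(\<lambda>j. ennreal (clamp_power (real j) (2 * k) x)) \<longlonglongrightarrow> ennreal (x ^ (2 * k))"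
        by (intro tendsto_eventually) (auto elim: eventually_mono)
      then show "ennreal (x ^ (2 * k)) = liminf (\<lambda>j. ennreal (clamp_power (real j) (2 * k) x))"
        by (simp add: lim_imp_Liminf)
    qed
    also have "\<dots> \<le> liminf (\<lambda>j. \<integral>\<^sup>+x. ennreal (clamp_power (real j) (2 * k) x) \<partial>M)"
      by (rule nn_integral_liminf) auto
    also have "\<dots> \<le> liminf (\<lambda>j::nat. ennreal (m (2 * k)))"
      by (intro Liminf_mono always_eventually allI)
        (auto simp: nn_integral_eq_integral cl_int M even_clamp intro!: ennreal_leI even_le)
    finally show ?thesis by (simp add: Liminf_const)
  qed
  have even_int: "integrable M (\<lambda>x. x ^ (2 * k))" for k
    by (rule integrableI_bounded)
      (use even_nn[of k] in \<open>auto simp: power_mult norm_power intro: le_less_trans\<close>)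
  have even_bound: "(\<integral>x. x ^ (2 * k) \<partial>M) \<le> m (2 * k)" and m_nonneg: "m (2 * k) \<ge> 0" for k
  proof -
    show nonneg: "m (2 * k) \<ge> 0"
      by (rule LIMSEQ_le_const[OF lim]) (auto simp: power_mult)
    have "ennreal (\<integral>x. x ^ (2 * k) \<partial>M) \<le> ennreal (m (2 * k))"
      using even_nn[of k] even_int[of k] by (subst nn_integral_eq_integral[symmetric]) (auto simp: power_mult)
    then show "(\<integral>x. x ^ (2 * k) \<partial>M) \<le> m (2 * k)"
      using nonneg by simp
  qed
  have intM: "integrable M (\<lambda>x. x ^ u)"
  proof (rule Bochner_Integration.integrable_bound[OF Bochner_Integration.integrable_add[OF even_int[of u] even_int[of 0]]])
    have "\<bar>x\<bar> ^ u \<le> x ^ (2 * u) + 1" for x :: real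
    proof -
      have "0 \<le> (\<bar>x\<bar> ^ u - 1)\<^sup>2 + (\<bar>x\<bar> ^ u)\<^sup>2 + 1" by simp
      also have "\<dots> = 2 * (x ^ (2 * u) - \<bar>x\<bar> ^ u + 1)"
        by (simp add: power2_eq_square algebra_simps flip: power_add mult_2)
          (simp add: mult.commute power_even_abs)
      finally show ?thesis by simp
    qed
    then show "AE x in M. norm (x ^ u) \<le> norm (x ^ (2 * u) + x ^ (2 * 0))"
      by (auto simp: power_abs power_mult intro!: AE_I2)
  qed simp
  have err: "\<bar>(\<integral>x. x ^ u \<partial>L) - integral\<^sup>L L (clamp_power K u)\<bar> \<le> 2 * (\<integral>x. x ^ (2 * u) \<partial>L) / K ^ u"
    if L: "real_distribution L" "integrable L (\<lambda>x. x ^ u)" "integrable L (\<lambda>x. x ^ (2 * u))" and K: "K > 0" for L K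
  proof -
    have "\<bar>(\<integral>x. x ^ u \<partial>L) - integral\<^sup>L L (clamp_power K u)\<bar> = \<bar>\<integral>x. x ^ u - clamp_power K u x \<partial>L\<bar>"
      using L K by (simp add: cl_int)
    also have "\<dots> \<le> (\<integral>x. \<bar>x ^ u - clamp_power K u x\<bar> \<partial>L)" by (rule integral_abs_bound)
    also have "\<dots> \<le> (\<integral>x. 2 * x ^ (2 * u) / K ^ u \<partial>L)"
      using L K by (intro integral_mono clamp_power_error) (auto simp: cl_int)
    finally show ?thesis by simp
  qed
  \<comment> \<open>One half of the constant 4 is the truncation error along \<open>\<nu>\<close>,
    the other half that for \<open>M\<close>.\<close>
  have diff: "\<bar>m u - (\<integral>x. x ^ u \<partial>M)\<bar> \<le> 4 * m (2 * u) / K ^ u" if K: "K > 0" for K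
  proof -
    have "\<bar>m u - integral\<^sup>L M (clamp_power K u)\<bar> \<le> 2 * m (2 * u) / K ^ u"
    proof (rule LIMSEQ_le)
      show "(\<lambda>n. \<bar>(\<integral>x. x ^ u \<partial>\<nu> n) - integral\<^sup>L (\<nu> n) (clamp_power K u)\<bar>) \<longlonglongrightarrow>
          \<bar>m u - integral\<^sup>L M (clamp_power K u)\<bar>"
        using K by (intro tendsto_intros lim conv) auto
      show "(\<lambda>n. 2 * (\<integral>x. x ^ (2 * u) \<partial>\<nu> n) / K ^ u) \<longlonglongrightarrow> 2 * m (2 * u) / K ^ u"
        using K by (intro tendsto_intros lim) auto
    qed (use err[OF \<nu> int int K] in blast)
    moreover have "\<bar>(\<integral>x. x ^ u \<partial>M) - integral\<^sup>L M (clamp_power K u)\<bar> \<le> 2 * m (2 * u) / K ^ u"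
      using err[OF M intM even_int K] even_bound[of u] K
      by (smt (verit) divide_right_mono zero_le_power)
    ultimately show ?thesis by linarith
  qed
  have "m u = (\<integral>x. x ^ u \<partial>M)"
  proof (cases "u = 0")
    \<comment> \<open>For \<open>u = 0\<close> the error bound does not shrink as \<open>K\<close>
      grows; here both sides are the total mass 1.\<close>
    case True
    have "(\<lambda>n. \<integral>x. x ^ 0 \<partial>\<nu> n) = (\<lambda>n. 1)"
      using real_distribution.axioms(1)[OF \<nu>] by (simp add: prob_space.prob_space)
    with lim[of 0] have "m 0 = 1" by (simp add: LIMSEQ_const_iff)
    then show ?thesis using True M.prob_space by simp
  next
    case False
    have "(\<lambda>j. 4 * m (2 * u) / real (Suc j) ^ u) \<longlonglongrightarrow> 0"
      using False by real_asymp
    moreover have "\<forall>\<^sub>F j in sequentially. norm (m u - (\<integral>x. x ^ u \<partial>M)) \<le> 4 * m (2 * u) / real (Suc j) ^ u"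
      by (intro always_eventually allI) (use diff[of "real (Suc j)" for j] in simp)
    ultimately have "(\<lambda>j::nat. m u - (\<integral>x. x ^ u \<partial>M)) \<longlonglongrightarrow> 0"
      by (rule Lim_null_comparison[rotated])
    then show ?thesis by (simp add: LIMSEQ_const_iff)
  qed
  with intM show ?thesis by (simp add: has_bochner_integral_iff)
qed


section \<open>Tightness and the limit theorem\<close>

text \<open>Markov's inequality for the square bounds the mass outside an interval uniformly in
  \<open>n\<close>.\<close>

lemma tight_of_second_moments:
  fixes \<nu> :: "nat \<Rightarrow> real measure"
  assumes \<nu>: "\<And>n. real_distribution (\<nu> n)"
    and int: "\<And>n. integrable (\<nu> n) (\<lambda>x. x\<^sup>2)"
    and bound: "\<And>n. (\<integral>x. x\<^sup>2 \<partial>\<nu> n) \<le> C"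
  shows "tight \<nu>"
  unfolding tight_def
proof (intro conjI allI impI \<nu>)
  fix \<epsilon> :: real assume \<epsilon>: "\<epsilon> > 0"
  have C: "C \<ge> 0"
    using bound[of 0] by (rule order_trans[rotated]) auto
  \<comment> \<open>Adding 1 keeps \<open>K\<close> positive and its square strictly above
    \<open>C / \<epsilon>\<close>, also when \<open>C = 0\<close>.\<close>
  define K where "K = sqrt (C / \<epsilon>) + 1"
  have K: "K > 0" "K\<^sup>2 > C / \<epsilon>"
  proof -
    show "K > 0" using C \<epsilon> by (simp add: K_def add_nonneg_pos)
    have "C / \<epsilon> = (sqrt (C / \<epsilon>))\<^sup>2" using C \<epsilon> by simp
    also have "\<dots> < K\<^sup>2" using C \<epsilon> by (intro power_strict_mono) (auto simp: K_def)
    finally show "K\<^sup>2 > C / \<epsilon>" .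
  qed
  have "measure (\<nu> n) {- (2 * K)<..2 * K} > 1 - \<epsilon>" for n
  proof -
    interpret real_distribution "\<nu> n" by (rule \<nu>)
    have "prob {x \<in> space (\<nu> n). K\<^sup>2 \<le> x\<^sup>2} \<le> (\<integral>x. x\<^sup>2 \<partial>\<nu> n) / K\<^sup>2"
      by (rule integral_Markov_inequality_measure[where A = "space (\<nu> n)"])
        (use int K in auto)
    also have "\<dots> \<le> C / K\<^sup>2" using bound K by (intro divide_right_mono) auto
    also have "\<dots> < \<epsilon>" using K \<epsilon> by (simp add: field_simps)
    finally have "prob {x \<in> space (\<nu> n). K\<^sup>2 \<le> x\<^sup>2} < \<epsilon>" .
    moreover have "prob (UNIV - {- (2 * K)<..2 * K}) \<le> prob {x \<in> space (\<nu> n). K\<^sup>2 \<le> x\<^sup>2}"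
    proof (rule finite_measure_mono)
      show "UNIV - {- (2 * K)<..2 * K} \<subseteq> {x \<in> space (\<nu> n). K\<^sup>2 \<le> x\<^sup>2}"
      proof
        fix x assume "x \<in> UNIV - {- (2 * K)<..2 * K}"
        then have "K \<le> \<bar>x\<bar>" using K by auto
        then show "x \<in> {x \<in> space (\<nu> n). K\<^sup>2 \<le> x\<^sup>2}"
          using K by (simp add: abs_le_square_iff[symmetric])
      qed
    qed simp
    ultimately show ?thesis using prob_compl[of "{- (2 * K)<..2 * K}"] by simp
  qed
  then show "\<exists>a b. a < b \<and> (\<forall>n. measure (\<nu> n) {a<..b} > 1 - \<epsilon>)"
    using K by (intro exI[of _ "- (2 * K)"] exI[of _ "2 * K"]) auto
qed

text \<open>Bounded second moments give tightness, hence a weakly convergent subsequence, and its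
  limit has the moments \<open>m\<close>. The growth bound makes the measure with these moments
  unique, so all subsequential limits coincide and the whole sequence converges.\<close>

theorem method_of_moments:
  fixes \<nu> :: "nat \<Rightarrow> real measure"
  assumes \<nu>: "\<And>n. real_distribution (\<nu> n)"
    and int: "\<And>n k. integrable (\<nu> n) (\<lambda>x. x ^ k)"
    and lim: "\<And>k. (\<lambda>n. \<integral>x. x ^ k \<partial>\<nu> n) \<longlonglongrightarrow> m k"
    and bound: "\<And>k. m k \<le> C ^ k * fact k" and C: "C > 0"
  shows "\<exists>!M. real_distribution M \<and> (\<forall>k. has_bochner_integral M (\<lambda>x. x ^ k) (m k))"
    and "real_distribution M \<Longrightarrow> (\<And>k. has_bochner_integral M (\<lambda>x. x ^ k) (m k)) \<Longrightarrow> weak_conv_m \<nu> M"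
proof -
  let ?P = "\<lambda>M. real_distribution M \<and> (\<forall>k. has_bochner_integral M (\<lambda>x. x ^ k) (m k))"
  have uniq: "M = N" if "?P M" "?P N" for M N
  proof -
    have intM: "integrable L (\<lambda>x. x ^ k)" and eqM: "(\<integral>x. x ^ k \<partial>L) = m k" if "?P L" for k L
      using that by (auto simp: has_bochner_integral_iff)
    have boundM: "(\<integral>x. \<bar>x\<bar> ^ k \<partial>L) \<le> (2 * C) ^ k * fact k" if "?P L" for k L
      by (rule absolute_moment_bound) (use that intM[OF that] eqM[OF that] bound C in auto)
    show ?thesis
      by (rule real_distribution_eqI_moments[where B = "2 * C"])
        (use that intM boundM eqM C in auto)
  qed
  have "Bseq (\<lambda>n. \<integral>x. x\<^sup>2 \<partial>\<nu> n)"
    using lim by (intro convergent_imp_Bseq) (auto simp: convergent_def)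
  then obtain K where K: "\<And>n. (\<integral>x. x\<^sup>2 \<partial>\<nu> n) \<le> K"
    by (metis BseqE abs_le_D1 real_norm_def)
  have tight: "tight \<nu>"
    by (rule tight_of_second_moments[OF \<nu> int]) (rule K)
  have sub: "?P L" if "strict_mono s" "real_distribution L" "weak_conv_m (\<nu> \<circ> s) L" for s L
    using moments_weak_limit[of "\<nu> \<circ> s" L m] that \<nu> int LIMSEQ_subseq_LIMSEQ[OF lim that(1)]
    by (auto simp: comp_def)
  obtain r M where "strict_mono (r :: nat \<Rightarrow> nat)" "real_distribution M" "weak_conv_m (\<nu> \<circ> id \<circ> r) M"
    using tight_imp_convergent_subsubsequence[OF tight strict_mono_id] by blast
  then have "?P M" using sub[of r M] by simp
  then show "\<exists>!M. ?P M" using uniq by blast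
  show "weak_conv_m \<nu> M" if M: "real_distribution M" "\<And>k. has_bochner_integral M (\<lambda>x. x ^ k) (m k)" for M
  proof (rule tight_subseq_weak_converge[OF \<nu> M(1) tight])
    fix s L assume *: "strict_mono s" "real_distribution L" "weak_conv_m (\<nu> \<circ> s) L"
    with sub uniq M have "L = M" by blast
    with * show "weak_conv_m (\<nu> \<circ> s) M" by simp
  qed
qed

section \<open>Averages over permutations\<close>

definition perm_avg :: "nat \<Rightarrow> ((nat \<Rightarrow> nat) \<Rightarrow> real) \<Rightarrow> real" where
  "perm_avg N F = (\<Sum>\<sigma> | \<sigma> permutes {1..N}. F \<sigma>) / fact N"

lemma perm_avg_compose_right:
  assumes "\<tau> permutes {1..N}"
  shows "perm_avg N (\<lambda>\<sigma>. F (\<sigma> \<circ> \<tau>)) = perm_avg N F"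
  unfolding perm_avg_def using sum_permutations_compose_right[OF assms, of F] by simp

lemma abs_perm_avg_le:
  assumes "\<And>\<sigma>. \<sigma> permutes {1..N} \<Longrightarrow> \<bar>F \<sigma>\<bar> \<le> c"
  shows "\<bar>perm_avg N F\<bar> \<le> c"
proof -
  have "\<bar>\<Sum>\<sigma> | \<sigma> permutes {1..N}. F \<sigma>\<bar> \<le> of_nat (card {\<sigma>. \<sigma> permutes {1..N}}) * c"
    using assms by (intro order_trans[OF sum_abs] sum_bounded_above) auto
  also have "\<dots> = fact N * c" by (simp add: card_permutations)
  finally show ?thesis by (simp add: perm_avg_def field_simps)
qed

text \<open>Compare the increasing enumerations of \<open>K\<close> and of its image under
  \<open>x\<close>: send \<open>a\<close> to the element of \<open>K\<close> whose rank in
  \<open>K\<close> is the rank of \<open>x a\<close> among the values.\<close>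

lemma order_isomorphic_permutation:
  fixes x :: "nat \<Rightarrow> nat"
  assumes K: "finite K" and inj: "inj_on x K"
  obtains \<rho> where "\<rho> permutes K" "\<And>a b. a \<in> K \<Longrightarrow> b \<in> K \<Longrightarrow> x a < x b \<longleftrightarrow> \<rho> a < \<rho> b"
proof -
  obtain h where h: "bij_betw h {..<card K} K" "strict_mono_on {..<card K} h"
    using ex_bij_betw_strict_mono_card[OF K] .
  have card: "card (x ` K) = card K" using inj by (rule card_image)
  obtain k where k: "bij_betw k {..<card K} (x ` K)" "strict_mono_on {..<card K} k"
    using ex_bij_betw_strict_mono_card[of "x ` K"] K unfolding card by blast
  define r where "r a = inv_into {..<card K} k (x a)" for a
  have r: "r a \<in> {..<card K}" "k (r a) = x a" if "a \<in> K" for a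
  proof -
    have "x a \<in> k ` {..<card K}" using that k(1) by (auto simp: bij_betw_def)
    then show "r a \<in> {..<card K}" "k (r a) = x a"
      unfolding r_def by (rule inv_into_into, rule f_inv_into_f)
  qed
  define \<rho> where "\<rho> a = (if a \<in> K then h (r a) else a)" for a
  have less: "x a < x b \<longleftrightarrow> \<rho> a < \<rho> b" if "a \<in> K" "b \<in> K" for a b
    using r[OF that(1)] r[OF that(2)] that strict_mono_on_less[OF h(2), of "r a" "r b"] strict_mono_on_less[OF k(2), of "r a" "r b"]
    by (simp add: \<rho>_def)
  have "inj_on \<rho> K"
  proof (rule inj_onI)
    fix a b assume ab: "a \<in> K" "b \<in> K" "\<rho> a = \<rho> b"
    with less[of a b] less[of b a] have "x a = x b" by simp
    with inj ab show "a = b" by (simp add: inj_on_eq_iff)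
  qed
  moreover have "\<rho> ` K \<subseteq> K"
    using h(1) r by (auto simp: \<rho>_def bij_betw_def)
  ultimately have "bij_betw \<rho> K K"
    using K by (simp add: bij_betw_def endo_inj_surj)
  then have "\<rho> permutes K" by (rule bij_imp_permutes) (simp add: \<rho>_def)
  with less that show ?thesis by blast
qed

text \<open>Precomposing with the permutations of \<open>K\<close> does not change the average over \<open>\<sigma>\<close>,
  while for a fixed \<open>\<sigma>\<close> these precompositions realize every relative order on \<open>K\<close>
  exactly once.\<close>

lemma perm_avg_order_invariant:
  fixes K :: "nat set" and \<Phi> :: "(nat \<Rightarrow> nat) \<Rightarrow> real"
  assumes K: "finite K" and \<iota>: "inj_on \<iota> K" "\<iota> ` K \<subseteq> {1..N}"
    and \<Phi>: "\<And>x y. (\<And>a b. a \<in> K \<Longrightarrow> b \<in> K \<Longrightarrow> x a < x b \<longleftrightarrow> y a < y b) \<Longrightarrow> \<Phi> x = \<Phi> y"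
  shows "perm_avg N (\<lambda>\<sigma>. \<Phi> (\<sigma> \<circ> \<iota>)) = (\<Sum>\<tau> | \<tau> permutes K. \<Phi> \<tau>) / fact (card K)"
proof -
  have bij: "bij_betw \<iota> K (\<iota> ` K)" using \<iota> by (simp add: bij_betw_def)
  have shift: "perm_avg N (\<lambda>\<sigma>. \<Phi> (\<sigma> \<circ> \<iota> \<circ> \<tau>)) = perm_avg N (\<lambda>\<sigma>. \<Phi> (\<sigma> \<circ> \<iota>))" if \<tau>: "\<tau> permutes K" for \<tau>
  proof -
    \<comment> \<open>\<open>\<tau>\<close> transported along \<open>\<iota>\<close> and extended by
      the identity, so that \<open>\<pi> \<circ> \<iota>\<close> and
      \<open>\<iota> \<circ> \<tau>\<close> agree on \<open>K\<close>.\<close>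
    define \<pi> where "\<pi> x = (if x \<in> \<iota> ` K then \<iota> (\<tau> (inv_into K \<iota> x)) else x)" for x
    have "\<pi> permutes \<iota> ` K"
      unfolding \<pi>_def by (rule permutes_bij_inv_into[OF \<tau> bij])
    then have \<pi>: "\<pi> permutes {1..N}" using \<iota>(2) by (rule permutes_subset)
    have "\<Phi> (\<sigma> \<circ> \<iota> \<circ> \<tau>) = \<Phi> (\<sigma> \<circ> \<pi> \<circ> \<iota>)" for \<sigma>
      by (rule \<Phi>) (use \<iota> in \<open>simp add: \<pi>_def\<close>)
    then show ?thesis
      using perm_avg_compose_right[OF \<pi>, of "\<lambda>\<sigma>. \<Phi> (\<sigma> \<circ> \<iota>)"] by simp
  qed
  have orders: "(\<Sum>\<tau> | \<tau> permutes K. \<Phi> (\<sigma> \<circ> \<iota> \<circ> \<tau>)) = (\<Sum>\<tau> | \<tau> permutes K. \<Phi> \<tau>)"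
    if \<sigma>: "\<sigma> permutes {1..N}" for \<sigma>
  proof -
    have "inj_on (\<sigma> \<circ> \<iota>) K"
      using \<iota>(1) permutes_inj_on[OF \<sigma>] by (rule comp_inj_on)
    \<comment> \<open>On \<open>K\<close> the order pattern of
      \<open>\<sigma> \<circ> \<iota>\<close> is that of a permutation \<open>\<rho>\<close>, and
      composing with \<open>\<rho>\<close> only reorders the sum over \<open>\<tau>\<close>.\<close>
    then obtain \<rho> where \<rho>: "\<rho> permutes K"
      "\<And>a b. a \<in> K \<Longrightarrow> b \<in> K \<Longrightarrow> (\<sigma> \<circ> \<iota>) a < (\<sigma> \<circ> \<iota>) b \<longleftrightarrow> \<rho> a < \<rho> b"
      using order_isomorphic_permutation[OF K] by blast
    have "(\<Sum>\<tau> | \<tau> permutes K. \<Phi> (\<sigma> \<circ> \<iota> \<circ> \<tau>)) = (\<Sum>\<tau> | \<tau> permutes K. \<Phi> (\<rho> \<circ> \<tau>))"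
    proof (rule sum.cong[OF refl])
      fix \<tau> assume "\<tau> \<in> {\<tau>. \<tau> permutes K}"
      then have "\<tau> a \<in> K" if "a \<in> K" for a using that by (simp add: permutes_in_image)
      then show "\<Phi> (\<sigma> \<circ> \<iota> \<circ> \<tau>) = \<Phi> (\<rho> \<circ> \<tau>)"
        by (intro \<Phi>) (use \<rho>(2) in simp)
    qed
    also have "\<dots> = (\<Sum>\<tau> | \<tau> permutes K. \<Phi> \<tau>)"
      using setum_permutations_compose_left[OF \<rho>(1), of \<Phi>] by simp
    finally show ?thesis .
  qed
  \<comment> \<open>Sum over both \<open>\<sigma>\<close> and \<open>\<tau>\<close> and evaluate in
    the two orders.\<close>
  have "fact (card K) * perm_avg N (\<lambda>\<sigma>. \<Phi> (\<sigma> \<circ> \<iota>)) = (\<Sum>\<tau> | \<tau> permutes K. perm_avg N (\<lambda>\<sigma>. \<Phi> (\<sigma> \<circ> \<iota> \<circ> \<tau>)))"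
    using shift by (simp add: card_permutations[OF refl K])
  also have "\<dots> = (\<Sum>\<sigma> | \<sigma> permutes {1..N}. \<Sum>\<tau> | \<tau> permutes K. \<Phi> (\<sigma> \<circ> \<iota> \<circ> \<tau>)) / fact N"
    unfolding perm_avg_def by (subst sum.swap) (simp add: sum_divide_distrib)
  also have "\<dots> = (\<Sum>\<tau> | \<tau> permutes K. \<Phi> \<tau>)"
    using orders by (simp add: card_permutations)
  finally show ?thesis by (simp add: field_simps)
qed

text \<open>An order-invariant statistic sees only which labels coincide: both sides reduce to the
  same average over permutations of the image of \<open>l\<close>, from which \<open>N\<close> and
  \<open>N'\<close> have disappeared.\<close>

lemma perm_avg_kernel:
  fixes \<Phi> :: "('a \<Rightarrow> nat) \<Rightarrow> real"
  assumes L: "finite L" and img: "l ` L \<subseteq> {1..N}" "l' ` L \<subseteq> {1..N'}"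
    and ker: "\<And>a b. a \<in> L \<Longrightarrow> b \<in> L \<Longrightarrow> l a = l b \<longleftrightarrow> l' a = l' b"
    and \<Phi>: "\<And>x y. (\<And>a b. a \<in> L \<Longrightarrow> b \<in> L \<Longrightarrow> x a < x b \<longleftrightarrow> y a < y b) \<Longrightarrow> \<Phi> x = \<Phi> y"
  shows "perm_avg N (\<lambda>\<sigma>. \<Phi> (\<sigma> \<circ> l)) = perm_avg N' (\<lambda>\<sigma>. \<Phi> (\<sigma> \<circ> l'))"
proof -
  \<comment> \<open>Sends \<open>l a\<close> to \<open>l' a\<close>; the equal coincidence patterns
    make this well defined and injective.\<close>
  define \<beta> where "\<beta> = l' \<circ> inv_into L l"
  have inv: "inv_into L l (l a) \<in> L" "l (inv_into L l (l a)) = l a" if "a \<in> L" for a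
    using that by (auto intro: inv_into_into f_inv_into_f)
  have \<beta>: "\<beta> (l a) = l' a" if "a \<in> L" for a
    using ker[of "inv_into L l (l a)" a] inv[OF that] that by (simp add: \<beta>_def)
  have \<Phi>l: "\<Phi> (x \<circ> l) = \<Phi> (y \<circ> l)" if "\<And>a b. a \<in> l ` L \<Longrightarrow> b \<in> l ` L \<Longrightarrow> x a < x b \<longleftrightarrow> y a < y b" for x y
    by (rule \<Phi>) (use that in simp)
  have "perm_avg N (\<lambda>\<sigma>. \<Phi> (\<sigma> \<circ> l)) = (\<Sum>\<tau> | \<tau> permutes l ` L. \<Phi> (\<tau> \<circ> l)) / fact (card (l ` L))"
    using perm_avg_order_invariant[of "l ` L" id N "\<lambda>x. \<Phi> (x \<circ> l)", OF _ _ _ \<Phi>l] L img(1)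
    by simp
  moreover have "perm_avg N' (\<lambda>\<sigma>. \<Phi> (\<sigma> \<circ> \<beta> \<circ> l)) = (\<Sum>\<tau> | \<tau> permutes l ` L. \<Phi> (\<tau> \<circ> l)) / fact (card (l ` L))"
  proof (rule perm_avg_order_invariant[of "l ` L" \<beta> N' "\<lambda>x. \<Phi> (x \<circ> l)"])
    show "inj_on \<beta> (l ` L)" using \<beta> ker by (auto simp: inj_on_def)
    show "\<beta> ` l ` L \<subseteq> {1..N'}" using \<beta> img(2) by auto
  qed (use L in simp, rule \<Phi>l, blast)
  moreover have "\<Phi> (\<sigma> \<circ> \<beta> \<circ> l) = \<Phi> (\<sigma> \<circ> l')" for \<sigma>
    by (rule \<Phi>) (simp add: \<beta>)
  ultimately show ?thesis by simp
qed

section \<open>Signed betweenness of random values\<close>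

text \<open>For distinct indices a factor is 1 or -1, according to direction, if the value at
  \<open>r i\<close> lies between those at \<open>p i\<close> and \<open>q i\<close>, and 0
  otherwise. This is one coordinate of a signed crossing.\<close>

definition cross_avg :: "nat \<Rightarrow> nat \<Rightarrow> (nat \<Rightarrow> nat) \<Rightarrow> (nat \<Rightarrow> nat) \<Rightarrow> (nat \<Rightarrow> nat) \<Rightarrow> real" where
  "cross_avg N u p q r =
     perm_avg N (\<lambda>\<sigma>. \<Prod>i<u. of_bool (\<sigma> (p i) < \<sigma> (r i)) - of_bool (\<sigma> (q i) < \<sigma> (r i)))"

lemma abs_cross_avg_le: "\<bar>cross_avg N u p q r\<bar> \<le> 1"
  unfolding cross_avg_def
  by (intro abs_perm_avg_le) (auto simp: abs_prod intro!: prod_le_1)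

lemma cross_avg_kernel:
  assumes img: "\<And>i. i < u \<Longrightarrow> p i \<in> {1..N} \<and> q i \<in> {1..N} \<and> r i \<in> {1..N}"
    and img': "\<And>i. i < u \<Longrightarrow> p' i \<in> {1..N'} \<and> q' i \<in> {1..N'} \<and> r' i \<in> {1..N'}"
    and ker: "\<And>i j. i < u \<Longrightarrow> j < u \<Longrightarrow>
      (p i = p j \<longleftrightarrow> p' i = p' j) \<and> (q i = q j \<longleftrightarrow> q' i = q' j) \<and> (r i = r j \<longleftrightarrow> r' i = r' j) \<and>
      (p i = q j \<longleftrightarrow> p' i = q' j) \<and> (p i = r j \<longleftrightarrow> p' i = r' j) \<and> (q i = r j \<longleftrightarrow> q' i = r' j)"
  shows "cross_avg N u p q r = cross_avg N' u p' q' r'"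
proof -
  let ?L = "{..<u} \<times> {..<3::nat}"
  \<comment> \<open>A single labelling for the three families: the second component 0, 1 or 2
    selects \<open>p\<close>, \<open>q\<close> or \<open>r\<close>.\<close>
  define l where "l = (\<lambda>(i, c :: nat). if c = 0 then p i else if c = 1 then q i else r i)"
  define l' where "l' = (\<lambda>(i, c :: nat). if c = 0 then p' i else if c = 1 then q' i else r' i)"
  define \<Phi> where "\<Phi> x = (\<Prod>i<u. of_bool (x (i, 0) < x (i, 2)) - of_bool (x (i, 1) < x (i, 2)) :: real)"
    for x :: "nat \<times> nat \<Rightarrow> nat"
  have "perm_avg N (\<lambda>\<sigma>. \<Phi> (\<sigma> \<circ> l)) = perm_avg N' (\<lambda>\<sigma>. \<Phi> (\<sigma> \<circ> l'))"
  proof (rule perm_avg_kernel[where L = ?L])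
    show "l ` ?L \<subseteq> {1..N}" using img by (force simp: l_def)
    show "l' ` ?L \<subseteq> {1..N'}" using img' by (force simp: l'_def)
    fix a b assume "a \<in> ?L" "b \<in> ?L"
    then obtain i c j d where ab: "a = (i, c)" "b = (j, d)" "i < u" "j < u" by blast
    note k1 = ker[OF ab(3,4)] and k2 = ker[OF ab(4,3)]
    have l: "l (i, c) = (if c = 0 then p i else if c = 1 then q i else r i)"
      "l' (i, c) = (if c = 0 then p' i else if c = 1 then q' i else r' i)" for i c
      by (simp_all add: l_def l'_def)
    show "l a = l b \<longleftrightarrow> l' a = l' b"
      unfolding ab l using k1 k2 by (smt (verit))
  qed (auto simp: \<Phi>_def)
  then show ?thesis by (simp add: cross_avg_def \<Phi>_def l_def l'_def)
qed

text \<open>Exchanging the values at \<open>p i\<close> and \<open>q i\<close> changes the sign of one factor only.\<close>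

lemma cross_avg_eq_0:
  assumes i: "i < u" and pq: "p i \<in> {1..N}" "q i \<in> {1..N}"
    and p: "\<And>j. j < u \<Longrightarrow> j \<noteq> i \<Longrightarrow> p j \<notin> {p i, q i}"
    and q: "\<And>j. j < u \<Longrightarrow> j \<noteq> i \<Longrightarrow> q j \<notin> {p i, q i}"
    and r: "\<And>j. j < u \<Longrightarrow> r j \<notin> {p i, q i}"
  shows "cross_avg N u p q r = 0"
proof -
  define \<tau> where "\<tau> = Transposition.transpose (p i) (q i)"
  define F where "F \<sigma> j = (of_bool (\<sigma> (p j) < \<sigma> (r j)) - of_bool (\<sigma> (q j) < \<sigma> (r j)) :: real)"
    for \<sigma> :: "nat \<Rightarrow> nat" and j
  have \<tau>: "\<tau> permutes {1..N}" unfolding \<tau>_def using pq by (rule permutes_swap_id)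
  have fix1: "\<tau> x = x" if "x \<notin> {p i, q i}" for x using that by (simp add: \<tau>_def Transposition.transpose_def)
  have "(\<Prod>j<u. F (\<sigma> \<circ> \<tau>) j) = - (\<Prod>j<u. F \<sigma> j)" for \<sigma>
  proof -
    have "F (\<sigma> \<circ> \<tau>) i = - F \<sigma> i"
      using fix1[OF r[OF i]] by (simp add: F_def \<tau>_def)
    moreover have "(\<Prod>j\<in>{..<u} - {i}. F (\<sigma> \<circ> \<tau>) j) = (\<Prod>j\<in>{..<u} - {i}. F \<sigma> j)"
      by (rule prod.cong) (auto simp: F_def fix1[OF p] fix1[OF q] fix1[OF r])
    ultimately show ?thesis using i by (simp add: prod.remove[of "{..<u}" i])
  qed
  then have "perm_avg N (\<lambda>\<sigma>. \<Prod>j<u. F \<sigma> j) = - perm_avg N (\<lambda>\<sigma>. \<Prod>j<u. F \<sigma> j)"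
    using perm_avg_compose_right[OF \<tau>, of "\<lambda>\<sigma>. \<Prod>j<u. F \<sigma> j"]
    by (simp add: perm_avg_def sum_negf)
  then show ?thesis by (simp add: cross_avg_def F_def)
qed

section \<open>Index tuples without isolated entries\<close>

text \<open>Ore's argument: the complement of a minimal dominating set is again dominating.\<close>

lemma small_dominating_set:
  assumes V: "finite V" and sym: "\<And>i j. r i j \<Longrightarrow> r j i"
    and nbr: "\<And>i. i \<in> V \<Longrightarrow> \<exists>j\<in>V. j \<noteq> i \<and> r i j"
  obtains C where "C \<subseteq> V" "2 * card C \<le> card V" "\<And>i. i \<in> V - C \<Longrightarrow> \<exists>j\<in>C. r i j"
proof -
  define dom where "dom C \<longleftrightarrow> C \<subseteq> V \<and> (\<forall>i\<in>V - C. \<exists>j\<in>C. r i j)" for C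
  have "dom V" by (simp add: dom_def)
  then obtain C where C: "dom C" "\<And>C'. dom C' \<Longrightarrow> card C \<le> card C'"
    using ex_has_least_nat[of dom V card] by blast
  have sub: "C \<subseteq> V" and fin: "finite C" using C(1) V finite_subset by (auto simp: dom_def)
  have compl: "\<exists>j\<in>V - C. r i j" if i: "i \<in> C" for i
  proof (rule ccontr)
    assume none: "\<not> ?thesis"
    obtain k where k: "k \<in> V" "k \<noteq> i" "r i k" using nbr i sub by blast
    have "dom (C - {i})"
      unfolding dom_def
    proof (intro conjI ballI)
      fix j assume j: "j \<in> V - (C - {i})"
      show "\<exists>k\<in>C - {i}. r j k"
      proof (cases "j = i")
        case True
        then show ?thesis using k none by blast
      next
        case False
        with j have "j \<in> V - C" by blast
        with C(1) obtain l where "l \<in> C" "r j l" by (auto simp: dom_def)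
        with none \<open>j \<in> V - C\<close> sym show ?thesis by blast
      qed
    qed (use sub in blast)
    from C(2)[OF this] have "card C \<le> card (C - {i})" .
    with i fin show False by (metis card_Diff1_less not_le)
  qed
  have card: "card (V - C) = card V - card C" "card C \<le> card V"
    using sub fin V by (auto intro: card_Diff_subset card_mono)
  show ?thesis
  proof (cases "2 * card C \<le> card V")
    case True
    show ?thesis by (rule that[OF sub True]) (use C(1) in \<open>auto simp: dom_def\<close>)
  next
    case False
    then have "2 * card (V - C) \<le> card V" using card by simp
    then show ?thesis by (rule that[of "V - C", OF Diff_subset]) (use compl in blast)
  qed
qed

section \<open>Cyclic neighbours and the number of tuples without isolated entries\<close>

definition cyc_pred :: "nat \<Rightarrow> nat \<Rightarrow> nat" where
  "cyc_pred n k = (if k = 1 then n else k - 1)"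

lemma cyc_suc_eq: "k \<in> {1..n} \<Longrightarrow> cyc_suc n k = (if k = n then 1 else k + 1)"
  by (cases "k = n") (simp_all add: cyc_suc_def)

lemma cyc_suc_in: "k \<in> {1..n} \<Longrightarrow> cyc_suc n k \<in> {1..n}"
  by (simp add: cyc_suc_eq)

lemma cyc_pred_in: "k \<in> {1..n} \<Longrightarrow> cyc_pred n k \<in> {1..n}"
  by (auto simp: cyc_pred_def)

lemma cyc_suc_pred:
  assumes "k \<in> {1..n}"
  shows "cyc_suc n (cyc_pred n k) = k"
  unfolding cyc_suc_eq[OF cyc_pred_in[OF assms]] using assms by (auto simp: cyc_pred_def)

lemma cyc_pred_suc:
  assumes "k \<in> {1..n}"
  shows "cyc_pred n (cyc_suc n k) = k"
  unfolding cyc_suc_eq[OF assms] using assms by (auto simp: cyc_pred_def)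

lemma cyc_suc_inj:
  assumes "a \<in> {1..n}" "b \<in> {1..n}"
  shows "cyc_suc n a = cyc_suc n b \<longleftrightarrow> a = b"
  using cyc_pred_suc[OF assms(1)] cyc_pred_suc[OF assms(2)] by metis

lemma cyc_suc_neq:
  assumes "n \<ge> 3" "k \<in> {1..n}"
  shows "cyc_suc n k \<noteq> k" "cyc_suc n (cyc_suc n k) \<noteq> k"
proof -
  have "cyc_suc n k = (if k = n then 1 else k + 1)"
    "cyc_suc n (cyc_suc n k) = (if cyc_suc n k = n then 1 else cyc_suc n k + 1)"
    by (rule cyc_suc_eq[OF assms(2)], rule cyc_suc_eq[OF cyc_suc_in[OF assms(2)]])
  with assms show "cyc_suc n k \<noteq> k" "cyc_suc n (cyc_suc n k) \<noteq> k"
    by (cases "k = n"; cases "cyc_suc n k = n"; simp)+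
qed

text \<open>The codes 0, 1, 2 name the positions near \<open>k\<close> independently of
  \<open>n\<close>, so that offsets can be counted and copied from one \<open>n\<close> to
  another.\<close>

definition cyc_shift :: "nat \<Rightarrow> nat \<Rightarrow> nat \<Rightarrow> nat" where
  "cyc_shift n c k = (if c = 0 then k else if c = 1 then cyc_suc n k else cyc_pred n k)"

lemma cyc_shift_in: "k \<in> {1..n} \<Longrightarrow> cyc_shift n c k \<in> {1..n}"
  using cyc_suc_in cyc_pred_in by (simp add: cyc_shift_def)

definition cyc_near :: "nat \<Rightarrow> nat \<Rightarrow> nat \<Rightarrow> bool" where
  "cyc_near n a b \<longleftrightarrow> a = b \<or> b = cyc_suc n a \<or> a = cyc_suc n b"

lemma cyc_near_sym: "cyc_near n a b \<Longrightarrow> cyc_near n b a"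
  by (auto simp: cyc_near_def)

lemma cyc_near_shift:
  assumes "cyc_near n a b" "a \<in> {1..n}" "b \<in> {1..n}"
  obtains c where "c < 3" "b = cyc_shift n c a"
proof -
  have "b = cyc_shift n 0 a \<or> b = cyc_shift n 1 a \<or> b = cyc_shift n 2 a"
    using assms by (auto simp: cyc_near_def cyc_shift_def cyc_pred_suc)
  with that[of 0] that[of 1] that[of 2] show ?thesis by auto
qed

definition index_fns :: "nat \<Rightarrow> nat \<Rightarrow> (nat \<Rightarrow> nat) set" where
  "index_fns n u = {..<u} \<rightarrow>\<^sub>E {1..n}"

lemma finite_index_fns [simp]: "finite (index_fns n u)"
  unfolding index_fns_def by (intro finite_PiE) auto

lemma index_fns_in: "f \<in> index_fns n u \<Longrightarrow> i < u \<Longrightarrow> f i \<in> {1..n}"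
  using PiE_mem[of f "{..<u}" "\<lambda>_. {1..n}" i] by (simp add: index_fns_def)

definition isolation_free :: "nat \<Rightarrow> nat \<Rightarrow> (nat \<Rightarrow> nat) \<Rightarrow> bool" where
  "isolation_free n u f \<longleftrightarrow> (\<forall>i<u. \<exists>j<u. j \<noteq> i \<and> cyc_near n (f i) (f j))"

text \<open>A dominated tuple is recovered from its values on \<open>C\<close> and, for each other
  index, a dominating member of \<open>C\<close> with one of three offsets.\<close>

lemma card_dominated_le:
  assumes C: "C \<subseteq> {..<u}"
  shows "card {f \<in> index_fns n u. \<forall>i\<in>{..<u} - C. \<exists>j\<in>C. cyc_near n (f j) (f i)}
    \<le> n ^ card C * (3 * card C) ^ (u - card C)" (is "card ?A \<le> _")
proof -
  let ?S = "(C \<rightarrow>\<^sub>E {1..n}) \<times> (({..<u} - C) \<rightarrow>\<^sub>E (C \<times> {..<3::nat}))"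
  define F where "F = (\<lambda>(v, h :: nat \<Rightarrow> nat \<times> nat). \<lambda>i. if i \<in> C then v i :: nat
    else if i < u then cyc_shift n (snd (h i)) (v (fst (h i))) else undefined)"
  have fin: "finite C" using C finite_subset by blast
  then have finS: "finite ?S" by (intro finite_cartesian_product finite_PiE) auto
  have "?A \<subseteq> F ` ?S"
  proof
    fix f assume "f \<in> ?A"
    then have f: "f \<in> index_fns n u" and dom: "\<forall>i\<in>{..<u} - C. \<exists>j\<in>C. cyc_near n (f j) (f i)" by auto
    have "\<forall>i\<in>{..<u} - C. \<exists>p. p \<in> C \<times> {..<3} \<and> f i = cyc_shift n (snd p) (f (fst p))"
    proof
      fix i assume i: "i \<in> {..<u} - C"
      with dom obtain j where j: "j \<in> C" "cyc_near n (f j) (f i)" by blast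
      then obtain c where "c < 3" "f i = cyc_shift n c (f j)"
        using cyc_near_shift index_fns_in[OF f] i C by (metis Diff_iff lessThan_iff subsetD)
      with j show "\<exists>p. p \<in> C \<times> {..<3} \<and> f i = cyc_shift n (snd p) (f (fst p))" by force
    qed
    then obtain h where h: "\<And>i. i \<in> {..<u} - C \<Longrightarrow> h i \<in> C \<times> {..<3} \<and> f i = cyc_shift n (snd (h i)) (f (fst (h i)))"
      by metis
    have "f = F (restrict f C, restrict h ({..<u} - C))"
    proof
      fix i
      have "f i = undefined" if "\<not> i < u" using f that by (auto simp: index_fns_def)
      moreover have "fst (h i) \<in> C" if "i < u" "i \<notin> C" using h[of i] that by auto
      ultimately show "f i = F (restrict f C, restrict h ({..<u} - C)) i"
        using h[of i] C by (auto simp: F_def)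
    qed
    moreover have "(restrict f C, restrict h ({..<u} - C)) \<in> ?S"
      using h index_fns_in[OF f] C by (auto simp: subset_eq)
    ultimately show "f \<in> F ` ?S" by blast
  qed
  then have "card ?A \<le> card ?S" using finS by (rule surj_card_le[rotated])
  also have "\<dots> = n ^ card C * (3 * card C) ^ (u - card C)"
    using C fin by (simp add: card_cartesian_product card_PiE card_Diff_subset mult.commute)
  finally show ?thesis .
qed

text \<open>Each such tuple is dominated by some \<open>C\<close> with
  \<open>2 * card C \<le> u\<close>. There are at most \<open>2 ^ u\<close> such sets, each costing
  a factor \<open>3 ^ u\<close> for offsets, and 36 is the square of \<open>2 * 3\<close>. Squaring
  the cardinality avoids the exponent \<open>u / 2\<close>.\<close>

lemma card_isolation_free_le:
  assumes n: "n \<ge> u"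
  shows "(real (card {f \<in> index_fns n u. isolation_free n u f}))\<^sup>2 \<le> 36 ^ u * real u ^ u * real n ^ u"
proof -
  let ?B = "\<lambda>C. {f \<in> index_fns n u. \<forall>i\<in>{..<u} - C. \<exists>j\<in>C. cyc_near n (f j) (f i)}"
  let ?I = "{C. C \<subseteq> {..<u} \<and> 2 * card C \<le> u}"
  have finI: "finite ?I" by (rule finite_subset[of _ "Pow {..<u}"]) auto
  have "{f \<in> index_fns n u. isolation_free n u f} \<subseteq> (\<Union>C\<in>?I. ?B C)"
  proof
    fix f assume f: "f \<in> {f \<in> index_fns n u. isolation_free n u f}"
    obtain C where C: "C \<subseteq> {..<u}" "2 * card C \<le> card {..<u}"
      "\<And>i. i \<in> {..<u} - C \<Longrightarrow> \<exists>j\<in>C. cyc_near n (f i) (f j)"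
      by (rule small_dominating_set[of "{..<u}" "\<lambda>i j. cyc_near n (f i) (f j)"])
        (use f in \<open>auto simp: isolation_free_def cyc_near_sym Bex_def\<close>)
    have "f \<in> ?B C" using f C(3) cyc_near_sym by blast
    with C(1,2) show "f \<in> (\<Union>C\<in>?I. ?B C)" by (intro UN_I[of C]) simp_all
  qed
  then have "card {f \<in> index_fns n u. isolation_free n u f} \<le> card (\<Union>C\<in>?I. ?B C)"
    by (intro card_mono finite_UN_I finI) auto
  also have "\<dots> \<le> (\<Sum>C\<in>?I. card (?B C))" by (rule card_UN_le[OF finI])
  finally have "real (card {f \<in> index_fns n u. isolation_free n u f}) \<le> (\<Sum>C\<in>?I. real (card (?B C)))"
    by (simp flip: of_nat_sum)
  also have "\<dots> \<le> (\<Sum>C\<in>?I. 3 ^ u * sqrt (real u ^ u * real n ^ u))"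
  proof (rule sum_mono)
    fix C assume "C \<in> ?I"
    then have C: "C \<subseteq> {..<u}" "2 * card C \<le> u" by auto
    define c where "c = card C"
    have "card (?B C) \<le> n ^ c * (3 * c) ^ (u - c)" unfolding c_def by (rule card_dominated_le[OF C(1)])
    also have "\<dots> \<le> n ^ c * (3 * u) ^ (u - c)"
      using C by (intro mult_left_mono power_mono) (auto simp: c_def)
    also have "\<dots> = 3 ^ (u - c) * (n ^ c * u ^ (u - c))" by (simp add: power_mult_distrib)
    also have "\<dots> \<le> 3 ^ u * (n ^ c * u ^ (u - c))"
      by (intro mult_right_mono power_increasing) auto
    finally have "real (card (?B C)) \<le> real (3 ^ u * (n ^ c * u ^ (u - c)))" by (rule of_nat_mono)
    also have "\<dots> = 3 ^ u * (real n ^ c * real u ^ (u - c))" by simp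
    also have "\<dots> \<le> 3 ^ u * sqrt (real u ^ u * real n ^ u)"
    proof (intro mult_left_mono real_le_rsqrt)
      have "(u - c) * 2 = u + (u - 2 * c)" using C(2) by (simp add: c_def)
      then have "(real n ^ c * real u ^ (u - c))\<^sup>2 = real n ^ (2 * c) * (real u ^ u * real u ^ (u - 2 * c))"
        by (simp only: power_mult_distrib power_mult[symmetric] power_add mult.commute[of c 2])
      \<comment> \<open>The surplus of \<open>u - 2 * c\<close> factors \<open>u\<close> is traded
        for factors \<open>n\<close>, which is where \<open>u \<le> n\<close> enters.\<close>
      also have "\<dots> \<le> real n ^ (2 * c) * (real u ^ u * real n ^ (u - 2 * c))"
        using n by (intro mult_left_mono power_mono) auto
      also have "\<dots> = real u ^ u * real n ^ u"
        using C(2) by (simp add: c_def flip: power_add)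
      finally show "(real n ^ c * real u ^ (u - c))\<^sup>2 \<le> real u ^ u * real n ^ u" .
    qed simp
    finally show "real (card (?B C)) \<le> 3 ^ u * sqrt (real u ^ u * real n ^ u)" .
  qed
  also have "\<dots> \<le> 2 ^ u * (3 ^ u * sqrt (real u ^ u * real n ^ u))"
  proof -
    have "card ?I \<le> card (Pow {..<u})" by (rule card_mono) auto
    then have "real (card ?I) \<le> 2 ^ u" by (simp add: card_Pow)
    then have "real (card ?I) * (3 ^ u * sqrt (real u ^ u * real n ^ u)) \<le> 2 ^ u * (3 ^ u * sqrt (real u ^ u * real n ^ u))"
      by (rule mult_right_mono) simp
    then show ?thesis by (simp only: sum_constant)
  qed
  also have "\<dots> = 6 ^ u * sqrt (real u ^ u * real n ^ u)"
    by (simp flip: power_mult_distrib)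
  finally have "(real (card {f \<in> index_fns n u. isolation_free n u f}))\<^sup>2 \<le> (6 ^ u * sqrt (real u ^ u * real n ^ u))\<^sup>2"
    by (rule power_mono) simp
  also have "\<dots> = 36 ^ u * real u ^ u * real n ^ u"
  proof -
    have "((6 :: real) ^ u)\<^sup>2 = (6\<^sup>2) ^ u" by (simp only: power_mult[symmetric] mult.commute)
    then show ?thesis by (simp add: power_mult_distrib)
  qed
  finally show ?thesis .
qed

section \<open>Tuples with a prescribed profile\<close>

lemma cyc_suc3_neq:
  assumes n: "n \<ge> 4" and k: "k \<in> {1..n}"
  shows "cyc_suc n (cyc_suc n (cyc_suc n k)) \<noteq> k"
proof -
  have 1: "cyc_suc n k = (if k = n then 1 else k + 1)"
    and 2: "cyc_suc n (cyc_suc n k) = (if cyc_suc n k = n then 1 else cyc_suc n k + 1)"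
    and 3: "cyc_suc n (cyc_suc n (cyc_suc n k)) =
      (if cyc_suc n (cyc_suc n k) = n then 1 else cyc_suc n (cyc_suc n k) + 1)"
    by (rule cyc_suc_eq[OF k], rule cyc_suc_eq[OF cyc_suc_in[OF k]],
        rule cyc_suc_eq[OF cyc_suc_in[OF cyc_suc_in[OF k]]])
  show ?thesis
    unfolding 3 unfolding 2 unfolding 1 using n k by auto
qed

text \<open>For \<open>n \<ge> 4\<close> predecessor, point and successor form a path that does not
  close up; for \<open>n = 3\<close> the successor's successor would be the predecessor.\<close>

lemma cyc_shift_eq_iff:
  assumes n: "n \<ge> 4" and a: "a \<in> {1..n}" and "c < 3" "d < 3"
  shows "cyc_shift n c a = cyc_shift n d a \<longleftrightarrow> c = d"
    and "cyc_shift n d a = cyc_suc n (cyc_shift n c a) \<longleftrightarrow> c = 0 \<and> d = 1 \<or> c = 2 \<and> d = 0"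
proof -
  define b where "b = cyc_pred n a"
  have b: "b \<in> {1..n}" "cyc_suc n b = a" unfolding b_def by (rule cyc_pred_in[OF a], rule cyc_suc_pred[OF a])
  have neq: "a \<noteq> b" "cyc_suc n a \<noteq> b" "cyc_suc n (cyc_suc n a) \<noteq> b"
    "cyc_suc n a \<noteq> a" "cyc_suc n (cyc_suc n a) \<noteq> a" "cyc_suc n (cyc_suc n a) \<noteq> cyc_suc n a"
    using cyc_suc_neq[OF _ b(1)] cyc_suc_neq[OF _ a] cyc_suc3_neq[OF n b(1)] cyc_suc_neq(1)[OF _ cyc_suc_in[OF a]] n
    unfolding b(2) by simp_all
  have shift: "cyc_shift n 0 a = a" "cyc_shift n (Suc 0) a = cyc_suc n a" "cyc_shift n 2 a = b"
    by (simp_all add: cyc_shift_def b_def)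
  have "c = 0 \<or> c = Suc 0 \<or> c = 2" "d = 0 \<or> d = Suc 0 \<or> d = 2" using assms by auto
  then show "cyc_shift n c a = cyc_shift n d a \<longleftrightarrow> c = d"
    "cyc_shift n d a = cyc_suc n (cyc_shift n c a) \<longleftrightarrow> c = 0 \<and> d = 1 \<or> c = 2 \<and> d = 0"
    by (elim disjE; simp add: shift neq neq[symmetric] b(2))+
qed

lemma cyc_shift_inverse:
  assumes "c < 3"
  obtains d where "d < 3" "\<And>a. a \<in> {1..n} \<Longrightarrow> cyc_shift n d (cyc_shift n c a) = a"
proof -
  have "c = 0 \<or> c = 1 \<or> c = 2" using assms by auto
  then have "\<exists>d<3. \<forall>a\<in>{1..n}. cyc_shift n d (cyc_shift n c a) = a"
  proof (elim disjE)
    assume "c = 0"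
    then show ?thesis by (intro exI[of _ 0]) (simp add: cyc_shift_def)
  next
    assume "c = 1"
    then show ?thesis by (intro exI[of _ 2]) (simp add: cyc_shift_def cyc_pred_suc del: atLeastAtMost_iff)
  next
    assume "c = 2"
    then show ?thesis by (intro exI[of _ 1]) (simp add: cyc_shift_def cyc_suc_pred del: atLeastAtMost_iff)
  qed
  with that show ?thesis by blast
qed

text \<open>Three shifts in a row: from a representative to an entry of its cluster, from there to a
  near entry, and back to the representative of that entry.\<close>

definition cyc_close :: "nat \<Rightarrow> nat \<Rightarrow> nat \<Rightarrow> bool" where
  "cyc_close n a b \<longleftrightarrow>
     b \<in> (\<lambda>(c, d, e). cyc_shift n e (cyc_shift n d (cyc_shift n c a))) ` ({..<3} \<times> {..<3} \<times> {..<3})"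

lemma cyc_closeI:
  "c < 3 \<Longrightarrow> d < 3 \<Longrightarrow> e < 3 \<Longrightarrow> b = cyc_shift n e (cyc_shift n d (cyc_shift n c a)) \<Longrightarrow> cyc_close n a b"
  unfolding cyc_close_def by (rule image_eqI[of _ _ "(c, d, e)"]) auto

lemma cyc_close_if_shifts_near:
  assumes "cyc_near n (cyc_shift n c a) (cyc_shift n d b)" "a \<in> {1..n}" "b \<in> {1..n}" "c < 3" "d < 3"
  shows "cyc_close n a b"
proof -
  obtain e where e: "e < 3" "cyc_shift n d b = cyc_shift n e (cyc_shift n c a)"
    using cyc_near_shift[OF assms(1)] cyc_shift_in assms(2,3) by metis
  obtain d' where d': "d' < 3" "cyc_shift n d' (cyc_shift n d b) = b"
    using cyc_shift_inverse[OF assms(5)] assms(3) by metis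
  show ?thesis by (rule cyc_closeI[OF assms(4) e(1) d'(1)]) (use e d' in simp)
qed

text \<open>The value at \<open>r'\<close> is a function of the value at \<open>r\<close> and of
  three codes, whence the factor \<open>27 = 3 ^ 3\<close>.\<close>

lemma card_cyc_close_pair_le:
  assumes R: "finite R" "r \<in> R" "r' \<in> R" "r \<noteq> r'"
  shows "card {v \<in> R \<rightarrow>\<^sub>E {1..n}. cyc_close n (v r) (v r')} \<le> 27 * n ^ (card R - 1)" (is "card ?A \<le> _")
proof -
  let ?T = "{..<3::nat} \<times> {..<3::nat} \<times> {..<3::nat}"
  let ?S = "((R - {r'}) \<rightarrow>\<^sub>E {1..n}) \<times> ?T"
  define F where "F = (\<lambda>(v :: 'a \<Rightarrow> nat, c, d, e). v(r' := cyc_shift n e (cyc_shift n d (cyc_shift n c (v r)))))"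
  have fin: "finite ?S" using R by (intro finite_cartesian_product finite_PiE) auto
  have "?A \<subseteq> F ` ?S"
  proof
    fix v assume "v \<in> ?A"
    then have v: "v \<in> R \<rightarrow>\<^sub>E {1..n}" and "cyc_close n (v r) (v r')" by auto
    then obtain c d e where cde: "(c, d, e) \<in> ?T" "v r' = cyc_shift n e (cyc_shift n d (cyc_shift n c (v r)))"
      by (auto simp: cyc_close_def)
    have "v = F (restrict v (R - {r'}), c, d, e)"
    proof
      fix x
      have "v x = undefined" if "x \<notin> R" using v that by (rule PiE_arb)
      then show "v x = F (restrict v (R - {r'}), c, d, e) x"
        using cde R by (cases "x = r'") (auto simp: F_def)
    qed
    moreover
    have "restrict v (R - {r'}) \<in> (R - {r'}) \<rightarrow>\<^sub>E {1..n}"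
      using v by (auto dest: PiE_mem)
    with cde(1) have "(restrict v (R - {r'}), c, d, e) \<in> ?S" by (simp only: mem_Times_iff fst_conv snd_conv)
    ultimately show "v \<in> F ` ?S" by (rule image_eqI)
  qed
  then have "card ?A \<le> card ?S" using fin by (rule surj_card_le[rotated])
  also have "\<dots> = 27 * n ^ (card R - 1)"
    using R by (simp add: card_cartesian_product card_PiE card_Diff_singleton)
  finally show ?thesis .
qed

text \<open>Union bound over the ordered pairs of distinct members of \<open>R\<close>.\<close>

lemma card_separated_ge:
  assumes R: "finite R"
  shows "n ^ card R \<le> card {v \<in> R \<rightarrow>\<^sub>E {1..n}. \<forall>r\<in>R. \<forall>r'\<in>R. r \<noteq> r' \<longrightarrow> \<not> cyc_close n (v r) (v r')}
    + 27 * (card R)\<^sup>2 * n ^ (card R - 1)" (is "_ \<le> card ?G + _")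
proof -
  let ?V = "R \<rightarrow>\<^sub>E {1..n}"
  let ?P = "{(r, r'). r \<in> R \<and> r' \<in> R \<and> r \<noteq> r'}"
  let ?B = "\<lambda>(r, r'). {v \<in> ?V. cyc_close n (v r) (v r')}"
  have finV: "finite ?V" using R by (intro finite_PiE) auto
  have P: "?P \<subseteq> R \<times> R" by auto
  then have finP: "finite ?P" using R finite_subset by blast
  have "?V \<subseteq> ?G \<union> (\<Union>p\<in>?P. ?B p)" by auto
  moreover have "finite (?G \<union> (\<Union>p\<in>?P. ?B p))"
    by (rule finite_subset[OF _ finV]) auto
  ultimately have "card ?V \<le> card (?G \<union> (\<Union>p\<in>?P. ?B p))" by (rule card_mono[rotated])
  also have "\<dots> \<le> card ?G + card (\<Union>p\<in>?P. ?B p)" by (rule card_Un_le)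
  finally have V: "card ?V \<le> card ?G + card (\<Union>p\<in>?P. ?B p)" .
  have "card (\<Union>p\<in>?P. ?B p) \<le> (\<Sum>p\<in>?P. card (?B p))" by (rule card_UN_le[OF finP])
  also have "\<dots> \<le> (\<Sum>p\<in>?P. 27 * n ^ (card R - 1))"
    by (rule sum_mono) (use card_cyc_close_pair_le[OF R] in auto)
  also have "\<dots> \<le> (card R)\<^sup>2 * (27 * n ^ (card R - 1))"
  proof -
    have "card ?P \<le> card (R \<times> R)" using P R by (intro card_mono) auto
    then have "card ?P * (27 * n ^ (card R - 1)) \<le> (card R)\<^sup>2 * (27 * n ^ (card R - 1))"
      by (intro mult_right_mono) (auto simp: power2_eq_square card_cartesian_product)
    then show ?thesis by (simp only: sum_constant of_nat_id)
  qed
  finally have "card (\<Union>p\<in>?P. ?B p) \<le> 27 * (card R)\<^sup>2 * n ^ (card R - 1)" by (simp only: mult_ac)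
  with V show ?thesis using R by (simp add: card_PiE)
qed

section \<open>Profiles, their clusters and their frequencies\<close>

text \<open>All that the averages see of a tuple, in a form that allows comparison between different
  \<open>n\<close>; for given \<open>u\<close> only finitely many profiles exist.\<close>

definition profile :: "nat \<Rightarrow> nat \<Rightarrow> (nat \<Rightarrow> nat) \<Rightarrow> (nat \<times> nat) set \<times> (nat \<times> nat) set" where
  "profile n u f =
     ({(i, j). i < u \<and> j < u \<and> f i = f j}, {(i, j). i < u \<and> j < u \<and> f j = cyc_suc n (f i)})"

definition profile_near :: "(nat \<times> nat) set \<times> (nat \<times> nat) set \<Rightarrow> (nat \<times> nat) set" where
  "profile_near D = fst D \<union> snd D \<union> (snd D)\<inverse>"

lemma profile_near_profile:
  "profile_near (profile n u f) = {(i, j). i < u \<and> j < u \<and> cyc_near n (f i) (f j)}"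
  by (auto simp: profile_near_def profile_def cyc_near_def)

definition profile_isolation_free where
  "profile_isolation_free u D \<longleftrightarrow> (\<forall>i<u. \<exists>j<u. j \<noteq> i \<and> (i, j) \<in> profile_near D)"

lemma isolation_free_profile: "isolation_free n u f \<longleftrightarrow> profile_isolation_free u (profile n u f)"
  by (auto simp: isolation_free_def profile_isolation_free_def profile_near_profile)

definition profile_count where
  "profile_count n u D = card {f \<in> index_fns n u. profile n u f = D}"

text \<open>\<open>f0\<close> is a template whose offsets can be copied to other \<open>n\<close>;
  \<open>n0 \<ge> 4\<close> ensures that the relations inside a cluster correspond to the offset
  codes.\<close>

locale realized_profile =
  fixes u n0 :: nat and f0 :: "nat \<Rightarrow> nat" and D
  assumes n0: "n0 \<ge> 4" and f0: "f0 \<in> index_fns n0 u" and D: "D = profile n0 u f0"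
    and free: "profile_isolation_free u D"
begin

text \<open>The least index in the connected component of the nearness graph. These components are
  the clusters.\<close>

definition rep :: "nat \<Rightarrow> nat" where
  "rep i = (LEAST j. (j, i) \<in> (profile_near D)\<^sup>*)"

definition R where "R = rep ` {..<u}"

lemma near_sym: "sym (profile_near D)"
  unfolding D profile_near_profile by (auto simp: sym_def cyc_near_sym)

lemma rep_rtrancl: "(rep i, i) \<in> (profile_near D)\<^sup>*"
  unfolding rep_def by (rule LeastI[of _ i]) simp

lemma rep_eq: "(i, j) \<in> (profile_near D)\<^sup>* \<Longrightarrow> rep i = rep j"
proof -
  assume ij: "(i, j) \<in> (profile_near D)\<^sup>*"
  have "sym ((profile_near D)\<^sup>*)" using near_sym by (rule sym_rtrancl)
  with ij have "(j, i) \<in> (profile_near D)\<^sup>*" by (rule symD[rotated])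
  with ij have "(k, i) \<in> (profile_near D)\<^sup>* \<longleftrightarrow> (k, j) \<in> (profile_near D)\<^sup>*" for k
    by (meson rtrancl_trans)
  then show ?thesis by (simp add: rep_def)
qed

lemma rep_le: "rep i \<le> i"
  unfolding rep_def by (rule Least_le) simp

lemma rep_rep: "rep (rep i) = rep i"
  by (rule rep_eq[OF rep_rtrancl])

lemma finite_R: "finite R" and R_subset: "R \<subseteq> {..<u}"
  using rep_le le_less_trans by (auto simp: R_def)

lemma rep_in: "i < u \<Longrightarrow> rep i \<in> R"
  by (simp add: R_def)

lemma rep_R: "r \<in> R \<Longrightarrow> rep r = r"
  using rep_rep by (auto simp: R_def)

text \<open>Along a chain of near indices the profile dictates each next value, so a tuple is
  determined by its values at the representatives.\<close>

lemma profile_count_le: "profile_count n u D \<le> n ^ card R"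
proof -
  let ?A = "{f \<in> index_fns n u. profile n u f = D}"
  have "inj_on (\<lambda>f. restrict f R) ?A"
  proof (rule inj_onI)
    fix f g assume f: "f \<in> ?A" and g: "g \<in> ?A" and eq: "restrict f R = restrict g R"
    have step: "f j = g j" if "(i, j) \<in> profile_near D" "f i = g i" for i j
    proof -
      have ij: "i < u" "j < u" "f i \<in> {1..n}" "f j \<in> {1..n}" "g j \<in> {1..n}"
        using that f g index_fns_in profile_near_profile[of n u f] by auto
      have "profile n u f = profile n u g" using f g by simp
      then have "f i = f j \<longleftrightarrow> g i = g j" "f j = cyc_suc n (f i) \<longleftrightarrow> g j = cyc_suc n (g i)"
        "f i = cyc_suc n (f j) \<longleftrightarrow> g i = cyc_suc n (g j)"
        using ij(1,2) by (auto simp: profile_def set_eq_iff)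
      moreover have "cyc_near n (f i) (f j)" using that f profile_near_profile[of n u f] by auto
      ultimately show ?thesis
        using that(2) cyc_suc_inj[OF ij(4,5)] unfolding cyc_near_def by metis
    qed
    show "f = g"
    proof
      fix i
      show "f i = g i"
      proof (cases "i < u")
        case True
        have "f j = g j" if "(rep i, j) \<in> (profile_near D)\<^sup>*" for j
          using that
        proof induction
          case base
          show ?case using rep_in[OF True] eq by (metis restrict_apply)
        qed (use step in blast)
        then show ?thesis using rep_rtrancl by blast
      next
        case False
        then show ?thesis using f g by (auto simp: index_fns_def PiE_def extensional_def)
      qed
    qed
  qed
  moreover have "(\<lambda>f. restrict f R) ` ?A \<subseteq> R \<rightarrow>\<^sub>E {1..n}"
    using R_subset index_fns_in by (auto simp: subset_eq)
  moreover have "finite (R \<rightarrow>\<^sub>E {1..n})" using finite_R by (intro finite_PiE) auto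
  ultimately have "card ?A \<le> card (R \<rightarrow>\<^sub>E {1..n})" by (rule card_inj_on_le)
  then show ?thesis using finite_R by (simp add: profile_count_def card_PiE)
qed

definition cls where "cls r = {i. i < u \<and> rep i = r}"

lemma two_le_card_cls: "r \<in> R \<Longrightarrow> 2 \<le> card (cls r)"
proof -
  assume r: "r \<in> R"
  then have "r < u" using R_subset by auto
  then obtain j where j: "j < u" "j \<noteq> r" "(r, j) \<in> profile_near D"
    using free by (auto simp: profile_isolation_free_def)
  then have "rep j = r" using rep_eq[OF r_into_rtrancl, of r j] rep_R[OF r] by simp
  then have "{r, j} \<subseteq> cls r" using j r \<open>r < u\<close> rep_R by (auto simp: cls_def)
  then have "card {r, j} \<le> card (cls r)" by (intro card_mono) (auto simp: cls_def)
  with j show ?thesis by simp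
qed

lemma sum_card_cls: "(\<Sum>r\<in>R. card (cls r)) = u"
proof -
  have "card (\<Union>r\<in>R. cls r) = (\<Sum>r\<in>R. card (cls r))"
    by (rule card_UN_disjoint) (auto simp: finite_R cls_def)
  moreover have "(\<Union>r\<in>R. cls r) = {..<u}" using rep_in by (auto simp: cls_def)
  ultimately show ?thesis by simp
qed

lemma card_R_le: "2 * card R \<le> u"
proof -
  have "(\<Sum>r\<in>R. 2) \<le> (\<Sum>r\<in>R. card (cls r))" using two_le_card_cls by (rule sum_mono)
  then show ?thesis by (simp add: sum_card_cls)
qed

text \<open>In the extremal case every cluster has exactly two members, so the only possible near
  partner of a non-representative is its representative.\<close>

lemma rep_near:
  assumes "2 * card R = u" "i < u"
  shows "(rep i, i) \<in> profile_near D"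
proof (cases "i = rep i")
  case True
  then show ?thesis using assms(2) by (simp add: D profile_near_profile cyc_near_def)
next
  case False
  have "(\<Sum>r\<in>R. 2) = (\<Sum>r\<in>R. card (cls r))" using assms(1) by (simp add: sum_card_cls)
  \<comment> \<open>Equal sums of termwise ordered numbers have equal terms.\<close>
  then have "2 = card (cls (rep i))"
    by (rule sum_mono_inv) (use two_le_card_cls rep_in assms(2) finite_R in auto)
  moreover have "{i, rep i} \<subseteq> cls (rep i)"
    using assms(2) rep_le[of i] rep_rep by (auto simp: cls_def)
  ultimately have cls: "cls (rep i) = {i, rep i}"
    using False by (intro card_subset_eq[symmetric]) (auto simp: cls_def)
  obtain j where j: "j < u" "j \<noteq> i" "(i, j) \<in> profile_near D"
    using free assms(2) by (auto simp: profile_isolation_free_def)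
  then have "j \<in> cls (rep i)" using rep_eq[OF r_into_rtrancl, of i j] by (simp add: cls_def)
  with cls j have "(i, rep i) \<in> profile_near D" by auto
  with near_sym show ?thesis by (rule symD)
qed

text \<open>Every separated choice of values at the representatives extends, by the offsets of the
  template, to a tuple with profile \<open>D\<close>; separated choices are almost all
  choices.\<close>

lemma profile_count_ge:
  assumes "2 * card R = u" "n \<ge> 4"
  shows "n ^ card R \<le> profile_count n u D + 27 * (card R)\<^sup>2 * n ^ (card R - 1)"
proof -
  let ?G = "{v \<in> R \<rightarrow>\<^sub>E {1..n}. \<forall>r\<in>R. \<forall>r'\<in>R. r \<noteq> r' \<longrightarrow> \<not> cyc_close n (v r) (v r')}"
  have "\<exists>c. \<forall>i<u. c i < 3 \<and> f0 i = cyc_shift n0 (c i) (f0 (rep i))"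
  proof -
    have "\<exists>c. c < 3 \<and> f0 i = cyc_shift n0 c (f0 (rep i))" if i: "i < u" for i
    proof -
      have "cyc_near n0 (f0 (rep i)) (f0 i)" "rep i < u"
        using rep_near[OF assms(1) i] by (auto simp: D profile_near_profile)
      then show ?thesis using cyc_near_shift index_fns_in[OF f0] i by metis
    qed
    then show ?thesis by metis
  qed
  then obtain c where c: "\<And>i. i < u \<Longrightarrow> c i < 3" "\<And>i. i < u \<Longrightarrow> f0 i = cyc_shift n0 (c i) (f0 (rep i))"
    by blast
  \<comment> \<open>Offset 0 at the representatives lets \<open>v\<close> be read off from
    \<open>F v\<close>, which gives injectivity.\<close>
  have c0: "c r = 0" if r: "r \<in> R" for r
  proof -
    have "r < u" using r R_subset by auto
    then have "cyc_shift n0 (c r) (f0 r) = cyc_shift n0 0 (f0 r)"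
      using c(2)[of r] rep_R[OF r] by (simp add: cyc_shift_def)
    then show ?thesis
      using cyc_shift_eq_iff(1)[OF n0 index_fns_in[OF f0 \<open>r < u\<close>] c(1)[OF \<open>r < u\<close>], of 0] by simp
  qed
  define F where "F v = (\<lambda>i. if i < u then cyc_shift n (c i) (v (rep i)) else undefined)" for v
  have "F v \<in> {f \<in> index_fns n u. profile n u f = D}" if v: "v \<in> ?G" for v
  proof -
    have vin: "v (rep i) \<in> {1..n}" if "i < u" for i
      using v rep_in[OF that] by (auto dest: PiE_mem)
    have "F v \<in> index_fns n u"
      unfolding index_fns_def by (rule PiE_I) (use vin cyc_shift_in in \<open>auto simp: F_def\<close>)
    moreover have "(F v i = F v j \<longleftrightarrow> f0 i = f0 j) \<and> (F v j = cyc_suc n (F v i) \<longleftrightarrow> f0 j = cyc_suc n0 (f0 i))"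
      if ij: "i < u" "j < u" for i j
    proof (cases "rep i = rep j")
      \<comment> \<open>Inside a cluster both relations depend only on the codes \<open>c i\<close>
        and \<open>c j\<close>, alike for \<open>n\<close> and \<open>n0\<close>.\<close>
      case True
      have "f0 (rep j) \<in> {1..n0}" using index_fns_in[OF f0] rep_le[of j] ij(2) le_less_trans by blast
      then show ?thesis
        using True c(2)[OF ij(1)] c(2)[OF ij(2)] ij
          cyc_shift_eq_iff[OF assms(2) vin[OF ij(2)] c(1)[OF ij(1)] c(1)[OF ij(2)]]
          cyc_shift_eq_iff[OF n0 _ c(1)[OF ij(1)] c(1)[OF ij(2)], of "f0 (rep j)"]
        by (simp add: F_def)
    next
      \<comment> \<open>Across clusters neither relation holds on either side: for \<open>f0\<close>
        because near indices share a representative, for \<open>F v\<close> by separation.\<close>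
      case False
      have "(i, j) \<notin> profile_near D" using rep_eq False by blast
      then have "\<not> cyc_near n0 (f0 i) (f0 j)" using ij by (simp add: D profile_near_profile)
      moreover have "\<not> cyc_close n (v (rep i)) (v (rep j))"
        using v False rep_in ij by blast
      then have "\<not> cyc_near n (F v i) (F v j)"
        using cyc_close_if_shifts_near[OF _ vin[OF ij(1)] vin[OF ij(2)] c(1)[OF ij(1)] c(1)[OF ij(2)]] ij
        by (auto simp: F_def)
      ultimately show ?thesis by (auto simp: cyc_near_def)
    qed
    then have "profile n u (F v) = D" unfolding D profile_def by auto
    ultimately show ?thesis by simp
  qed
  moreover have "inj_on F ?G"
  proof (rule inj_onI)
    fix v w assume vw: "v \<in> ?G" "w \<in> ?G" "F v = F w"
    have "v r = w r" if "r \<in> R" for r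
      using fun_cong[OF vw(3), of r] that R_subset rep_R[OF that] c0[OF that]
      by (auto simp: F_def cyc_shift_def)
    then show "v = w" using vw by (intro PiE_ext[of v R _ w]) auto
  qed
  ultimately have "card ?G \<le> profile_count n u D"
    unfolding profile_count_def by (intro card_inj_on_le[of F]) auto
  with card_separated_ge[OF finite_R, of n] show ?thesis by linarith
qed

text \<open>With fewer than \<open>u / 2\<close> clusters the quotient is at most
  \<open>1 / sqrt (real n)\<close> and tends to 0. With exactly \<open>u / 2\<close> clusters, all
  of them pairs, the upper and lower counts differ by a lower order and the limit is 1.\<close>

lemma profile_count_convergent: "convergent (\<lambda>n. real (profile_count n u D) / sqrt (real n) ^ u)"
proof (cases "2 * card R = u")
  case False
  then have lt: "2 * card R < u" using card_R_le by simp
  have "\<forall>\<^sub>F n in sequentially. norm (real (profile_count n u D) / sqrt (real n) ^ u) \<le> 1 / sqrt (real n)"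
    using eventually_ge_at_top[of 1]
  proof eventually_elim
    fix n :: nat assume n: "n \<ge> 1"
    have "real (profile_count n u D) * sqrt (real n) \<le> real n ^ card R * sqrt (real n)"
      using profile_count_le[of n] n by (intro mult_right_mono) (simp_all flip: of_nat_power)
    also have "\<dots> = sqrt (real n) ^ (2 * card R + 1)"
      by (simp add: power_mult)
    also have "\<dots> \<le> sqrt (real n) ^ u" using lt n by (intro power_increasing) auto
    finally show "norm (real (profile_count n u D) / sqrt (real n) ^ u) \<le> 1 / sqrt (real n)"
      using n by (simp add: field_simps)
  qed
  moreover have "(\<lambda>n. 1 / sqrt (real n)) \<longlonglongrightarrow> 0" by real_asymp
  ultimately have "(\<lambda>n. real (profile_count n u D) / sqrt (real n) ^ u) \<longlonglongrightarrow> 0"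
    by (rule Lim_null_comparison)
  then show ?thesis by (auto simp: convergent_def)
next
  case True
  define m where "m = card R"
  have sq: "sqrt (real n) ^ u = real n ^ m" for n
  proof -
    have "sqrt (real n) ^ u = sqrt (real n) ^ (2 * m)" unfolding m_def True ..
    then show ?thesis by (simp add: power_mult)
  qed
  have "(\<lambda>n. real (profile_count n u D) / sqrt (real n) ^ u) \<longlonglongrightarrow> 1"
  proof (rule tendsto_sandwich)
    show "(\<lambda>n. 1 - 27 * (real m)\<^sup>2 / real n) \<longlonglongrightarrow> 1" by real_asymp
    show "\<forall>\<^sub>F n in sequentially. 1 - 27 * (real m)\<^sup>2 / real n \<le> real (profile_count n u D) / sqrt (real n) ^ u"
      using eventually_ge_at_top[of 4]
    proof eventually_elim
      fix n :: nat assume n: "n \<ge> 4"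
      have "real (n ^ m) \<le> real (profile_count n u D + 27 * m\<^sup>2 * n ^ (m - 1))"
        using profile_count_ge[OF True n] unfolding m_def by (rule of_nat_mono)
      \<comment> \<open>For \<open>m = 0\<close> the exponent \<open>m - 1\<close> is truncated, but
        then both sides vanish.\<close>
      moreover have "27 * (real m)\<^sup>2 * real n ^ (m - 1) = 27 * (real m)\<^sup>2 / real n * real n ^ m"
        using n by (cases m) auto
      ultimately show "1 - 27 * (real m)\<^sup>2 / real n \<le> real (profile_count n u D) / sqrt (real n) ^ u"
        using n unfolding sq by (simp add: pos_le_divide_eq left_diff_distrib)
    qed
    show "\<forall>\<^sub>F n in sequentially. real (profile_count n u D) / sqrt (real n) ^ u \<le> 1"
      using eventually_ge_at_top[of 1]
    proof eventually_elim
      fix n :: nat assume n: "n \<ge> 1"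
      show "real (profile_count n u D) / sqrt (real n) ^ u \<le> 1"
        using profile_count_le[of n] n unfolding sq m_def by (simp flip: of_nat_power)
    qed
  qed simp
  then show ?thesis by (auto simp: convergent_def)
qed

end

lemma profile_count_convergent:
  assumes "profile_isolation_free u D"
  shows "convergent (\<lambda>n. real (profile_count n u D) / sqrt (real n) ^ u)"
proof (cases "\<exists>n\<ge>4. \<exists>f\<in>index_fns n u. profile n u f = D")
  case True
  then obtain n f where "n \<ge> 4" "f \<in> index_fns n u" "profile n u f = D" by blast
  then interpret realized_profile u n f D by unfold_locales (use assms in auto)
  show ?thesis by (rule profile_count_convergent)
next
  \<comment> \<open>A profile that no \<open>n \<ge> 4\<close> realizes has count 0 from there
    on.\<close>
  case False
  have "\<forall>\<^sub>F n in sequentially. real (profile_count n u D) / sqrt (real n) ^ u = 0"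
    using eventually_ge_at_top[of 4]
  proof eventually_elim
    fix n :: nat assume "n \<ge> 4"
    with False have "{f \<in> index_fns n u. profile n u f = D} = {}" by blast
    then show "real (profile_count n u D) / sqrt (real n) ^ u = 0" by (simp add: profile_count_def)
  qed
  then show ?thesis unfolding convergent_def by (intro exI[of _ 0] tendsto_eventually)
qed

section \<open>Moments of the linking number\<close>

text \<open>Independence of \<open>\<sigma>\<close> and \<open>\<pi>\<close> splits the mean into
  two averages. The first concerns vertical edges lying between the ends of horizontal ones, the
  second horizontal edges lying between the ends of vertical ones. The sign \<open>(- 1) ^ u\<close>
  is kept outside.\<close>

definition index_term :: "nat \<Rightarrow> nat \<Rightarrow> (nat \<Rightarrow> nat) \<Rightarrow> (nat \<Rightarrow> nat) \<Rightarrow> real" where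
  "index_term n u f g =
     cross_avg (2 * n) u f (\<lambda>i. cyc_suc n (f i)) (\<lambda>i. n + g i) *
     cross_avg (2 * n) u (\<lambda>i. n + g i) (\<lambda>i. n + cyc_suc n (g i)) (\<lambda>i. cyc_suc n (f i))"

lemma expectation_random_grid_pair:
  "measure_pmf.expectation (random_grid_pair n) h =
     (\<Sum>\<sigma> | \<sigma> permutes {1..2 * n}. \<Sum>\<pi> | \<pi> permutes {1..2 * n}. h (\<sigma>, \<pi>)) / (fact (2 * n))\<^sup>2"
  for h :: "_ \<Rightarrow> real"
proof -
  let ?P = "{\<sigma>. \<sigma> permutes {1..2 * n}}"
  have P: "finite ?P" "?P \<noteq> {}" "card ?P = fact (2 * n)"
    using permutes_id[of "{1..2 * n}"] finite_permutations[of "{1..2 * n}"] card_permutations[of "{1..2 * n}" "2 * n"]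
    by (simp, blast, simp)
  have "measure_pmf.expectation (random_grid_pair n) h =
      (\<Sum>p\<in>?P \<times> ?P. pmf (random_grid_pair n) p * h p)"
    using P by (subst integral_measure_pmf[of "?P \<times> ?P"]) (auto simp: random_grid_pair_def set_pmf_of_set)
  also have "\<dots> = (\<Sum>(\<sigma>, \<pi>)\<in>?P \<times> ?P. h (\<sigma>, \<pi>) / (fact (2 * n))\<^sup>2)"
    by (intro sum.cong refl)
      (auto simp: random_grid_pair_def pmf_pair power2_eq_square pmf_of_set[OF P(2,1)] P(3) simp del: One_nat_def)
  also have "\<dots> = (\<Sum>\<sigma>\<in>?P. \<Sum>\<pi>\<in>?P. h (\<sigma>, \<pi>)) / (fact (2 * n))\<^sup>2"
    by (simp add: sum.cartesian_product sum_divide_distrib case_prod_unfold)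
  finally show ?thesis .
qed

lemma finite_set_pmf_random_grid_pair: "finite (set_pmf (random_grid_pair n))"
proof -
  let ?P = "{\<sigma>. \<sigma> permutes {1..2 * n}}"
  have P: "finite ?P" "?P \<noteq> {}" using permutes_id[of "{1..2 * n}"] by (simp add: finite_permutations, blast)
  then show ?thesis by (simp add: random_grid_pair_def set_pmf_of_set)
qed

lemma power_double_sum:
  fixes c :: "nat \<Rightarrow> nat \<Rightarrow> real"
  shows "(\<Sum>k=1..n. \<Sum>l=1..n. c k l) ^ u =
    (\<Sum>f\<in>index_fns n u. \<Sum>g\<in>index_fns n u. \<Prod>i<u. c (f i) (g i))"
proof -
  have "(\<Sum>k=1..n. \<Sum>l=1..n. c k l) ^ u = (\<Prod>i<u. \<Sum>k\<in>{1..n}. \<Sum>l=1..n. c k l)" by simp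
  also have "\<dots> = (\<Sum>f\<in>index_fns n u. \<Prod>i<u. \<Sum>l\<in>{1..n}. c (f i) l)"
    unfolding index_fns_def by (rule prod_sum_PiE) auto
  also have "\<dots> = (\<Sum>f\<in>index_fns n u. \<Sum>g\<in>index_fns n u. \<Prod>i<u. c (f i) (g i))"
    unfolding index_fns_def by (intro sum.cong refl prod_sum_PiE) auto
  finally show ?thesis .
qed

text \<open>The compared values are distinct, so a negated inequality is a strict reverse one and
  finitely many orderings remain. If both differences are 1, the crossing is negative; hence the
  minus sign.\<close>

lemma grid_eps_eq:
  assumes \<sigma>: "\<sigma> permutes {1..2 * n}" and \<pi>: "\<pi> permutes {1..2 * n}" and k: "k \<in> {1..n}" and l: "l \<in> {1..n}"
  shows "real_of_int (grid_eps n \<sigma> \<pi> k l) =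
    - ((of_bool (\<sigma> k < \<sigma> (n + l)) - of_bool (\<sigma> (cyc_suc n k) < \<sigma> (n + l))) *
       (of_bool (\<pi> (n + l) < \<pi> (cyc_suc n k)) - of_bool (\<pi> (n + cyc_suc n l) < \<pi> (cyc_suc n k))))"
proof -
  have ranges: "k \<le> n" "cyc_suc n k \<le> n" "l > 0" "cyc_suc n l > 0"
    using k l cyc_suc_in[OF k] cyc_suc_in[OF l] by auto
  have "\<sigma> k \<noteq> \<sigma> (n + l)" "\<sigma> (cyc_suc n k) \<noteq> \<sigma> (n + l)"
    "\<pi> (n + l) \<noteq> \<pi> (cyc_suc n k)" "\<pi> (n + cyc_suc n l) \<noteq> \<pi> (cyc_suc n k)"
    using ranges inj_eq[OF permutes_inj[OF \<sigma>]] inj_eq[OF permutes_inj[OF \<pi>]] by auto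
  moreover have "real_of_int (if (x < x' \<and> x' < x1 \<and> y1' < y1 \<and> y1 < y') \<or> (x1 < x' \<and> x' < x \<and> y' < y1 \<and> y1 < y1') then 1
      else if (x < x' \<and> x' < x1 \<and> y' < y1 \<and> y1 < y1') \<or> (x1 < x' \<and> x' < x \<and> y1' < y1 \<and> y1 < y') then - 1
      else 0) = - ((of_bool (x < x') - of_bool (x1 < x')) * (of_bool (y' < y1) - of_bool (y1' < y1)))"
    if "x \<noteq> x'" "x1 \<noteq> x'" "y' \<noteq> y1" "y1' \<noteq> y1" for x x' x1 y1 y' y1' :: nat
    using that by (cases "x < x'"; cases "x1 < x'"; cases "y' < y1"; cases "y1' < y1") auto
  ultimately show ?thesis unfolding grid_eps_def Let_def by blast
qed

lemma moment_expansion: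
  "measure_pmf.expectation (random_grid_pair n) (\<lambda>p. normalized_lk n p ^ u) =
     (- 1) ^ u * (\<Sum>f\<in>index_fns n u. \<Sum>g\<in>index_fns n u. index_term n u f g) / real n ^ u"
proof -
  let ?P = "{\<sigma>. \<sigma> permutes {1..2 * n}}" and ?I = "index_fns n u"
  define a where "a \<sigma> k l = (of_bool (\<sigma> k < \<sigma> (n + l)) - of_bool (\<sigma> (cyc_suc n k) < \<sigma> (n + l)) :: real)"
    for \<sigma> :: "nat \<Rightarrow> nat" and k l
  define b where "b \<pi> k l = (of_bool (\<pi> (n + l) < \<pi> (cyc_suc n k)) - of_bool (\<pi> (n + cyc_suc n l) < \<pi> (cyc_suc n k)) :: real)"
    for \<pi> :: "nat \<Rightarrow> nat" and k l
  have lk: "normalized_lk n (\<sigma>, \<pi>) ^ u =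
      (- 1) ^ u * (\<Sum>f\<in>?I. \<Sum>g\<in>?I. (\<Prod>i<u. a \<sigma> (f i) (g i)) * (\<Prod>i<u. b \<pi> (f i) (g i))) / real n ^ u"
    if "\<sigma> \<in> ?P" "\<pi> \<in> ?P" for \<sigma> \<pi>
  proof -
    have \<sigma>\<pi>: "\<sigma> permutes {1..2 * n}" "\<pi> permutes {1..2 * n}" using that by simp_all
    have "real_of_int (linking_number (grid_link n \<sigma> \<pi>)) = (\<Sum>k=1..n. \<Sum>l=1..n. real_of_int (grid_eps n \<sigma> \<pi> k l))"
      by (simp add: linking_number_grid_link[OF \<sigma>\<pi>(1)])
    also have "\<dots> = (\<Sum>k=1..n. \<Sum>l=1..n. - (a \<sigma> k l * b \<pi> k l))"
      unfolding a_def b_def by (intro sum.cong refl grid_eps_eq[OF \<sigma>\<pi>])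
    also have "\<dots> = - (\<Sum>k=1..n. \<Sum>l=1..n. a \<sigma> k l * b \<pi> k l)" by (simp add: sum_negf)
    finally have lk: "real_of_int (linking_number (grid_link n \<sigma> \<pi>)) = - (\<Sum>k=1..n. \<Sum>l=1..n. a \<sigma> k l * b \<pi> k l)" .
    show ?thesis
      unfolding normalized_lk_def prod.case lk power_divide
      by (subst power_minus) (simp only: power_double_sum prod.distrib)
  qed
  have "(\<Sum>\<sigma>\<in>?P. \<Sum>\<pi>\<in>?P. normalized_lk n (\<sigma>, \<pi>) ^ u) =
      (- 1) ^ u * (\<Sum>\<sigma>\<in>?P. \<Sum>\<pi>\<in>?P. \<Sum>f\<in>?I. \<Sum>g\<in>?I. (\<Prod>i<u. a \<sigma> (f i) (g i)) * (\<Prod>i<u. b \<pi> (f i) (g i))) / real n ^ u"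
    by (simp add: lk sum_distrib_left sum_divide_distrib)
  \<comment> \<open>After exchanging sums, each summand is a function of \<open>\<sigma>\<close>
    times a function of \<open>\<pi>\<close>, so the inner double sum factorizes.\<close>
  also have "(\<Sum>\<sigma>\<in>?P. \<Sum>\<pi>\<in>?P. \<Sum>f\<in>?I. \<Sum>g\<in>?I. (\<Prod>i<u. a \<sigma> (f i) (g i)) * (\<Prod>i<u. b \<pi> (f i) (g i))) =
      (\<Sum>f\<in>?I. \<Sum>g\<in>?I. (\<Sum>\<sigma>\<in>?P. \<Prod>i<u. a \<sigma> (f i) (g i)) * (\<Sum>\<pi>\<in>?P. \<Prod>i<u. b \<pi> (f i) (g i)))"
  proof -
    let ?x = "\<lambda>\<sigma> \<pi> f g. (\<Prod>i<u. a \<sigma> (f i) (g i)) * (\<Prod>i<u. b \<pi> (f i) (g i))"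
    have "(\<Sum>\<sigma>\<in>?P. \<Sum>\<pi>\<in>?P. \<Sum>f\<in>?I. \<Sum>g\<in>?I. ?x \<sigma> \<pi> f g) = (\<Sum>\<sigma>\<in>?P. \<Sum>f\<in>?I. \<Sum>\<pi>\<in>?P. \<Sum>g\<in>?I. ?x \<sigma> \<pi> f g)"
      by (rule sum.cong[OF refl], rule sum.swap)
    also have "\<dots> = (\<Sum>f\<in>?I. \<Sum>\<sigma>\<in>?P. \<Sum>\<pi>\<in>?P. \<Sum>g\<in>?I. ?x \<sigma> \<pi> f g)" by (rule sum.swap)
    also have "\<dots> = (\<Sum>f\<in>?I. \<Sum>\<sigma>\<in>?P. \<Sum>g\<in>?I. \<Sum>\<pi>\<in>?P. ?x \<sigma> \<pi> f g)"
      by (rule sum.cong[OF refl], rule sum.cong[OF refl], rule sum.swap)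
    also have "\<dots> = (\<Sum>f\<in>?I. \<Sum>g\<in>?I. \<Sum>\<sigma>\<in>?P. \<Sum>\<pi>\<in>?P. ?x \<sigma> \<pi> f g)"
      by (rule sum.cong[OF refl], rule sum.swap)
    finally show ?thesis by (simp only: sum_product)
  qed
  also have "\<dots> = (\<Sum>f\<in>?I. \<Sum>g\<in>?I. (fact (2 * n))\<^sup>2 * index_term n u f g)"
    by (simp add: index_term_def cross_avg_def perm_avg_def a_def b_def power2_eq_square)
  finally have "(\<Sum>\<sigma>\<in>?P. \<Sum>\<pi>\<in>?P. normalized_lk n (\<sigma>, \<pi>) ^ u) / (fact (2 * n))\<^sup>2 =
      (- 1) ^ u * (\<Sum>f\<in>?I. \<Sum>g\<in>?I. index_term n u f g) / real n ^ u"
    by (simp flip: sum_distrib_left)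
  then show ?thesis by (simp only: expectation_random_grid_pair)
qed

lemma abs_index_term_le: "\<bar>index_term n u f g\<bar> \<le> 1"
  unfolding index_term_def abs_mult by (intro mult_le_one abs_cross_avg_le) simp

text \<open>If \<open>f i\<close> is isolated, neither it nor its successor occurs among the indices
  of the other factors, so the swap argument kills the first average; an isolated \<open>g i\<close>
  kills the second. The third index of each factor lies in the other half of
  \<open>{1..2 * n}\<close>.\<close>

lemma index_term_eq_0:
  assumes f: "f \<in> index_fns n u" and g: "g \<in> index_fns n u"
    and iso: "\<not> (isolation_free n u f \<and> isolation_free n u g)"
  shows "index_term n u f g = 0"
proof -
  have fin: "f i \<in> {1..n}" "cyc_suc n (f i) \<in> {1..n}" if "i < u" for i
    by (rule index_fns_in[OF f that], rule cyc_suc_in[OF index_fns_in[OF f that]])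
  have gin: "g i \<in> {1..n}" "cyc_suc n (g i) \<in> {1..n}" if "i < u" for i
    by (rule index_fns_in[OF g that], rule cyc_suc_in[OF index_fns_in[OF g that]])
  have sep: "f i < n + g j" "cyc_suc n (f i) < n + g j" "cyc_suc n (f i) < n + cyc_suc n (g j)"
    if "i < u" "j < u" for i j
    using fin[OF that(1)] gin[OF that(2)] by auto
  consider "\<not> isolation_free n u f" | "\<not> isolation_free n u g" using iso by blast
  then show ?thesis
  proof cases
    case 1
    then obtain i where i: "i < u" "\<And>j. j < u \<Longrightarrow> j \<noteq> i \<Longrightarrow> \<not> cyc_near n (f i) (f j)"
      by (auto simp: isolation_free_def)
    have "cross_avg (2 * n) u f (\<lambda>i. cyc_suc n (f i)) (\<lambda>i. n + g i) = 0"
    proof (rule cross_avg_eq_0[OF i(1)])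
      show "f i \<in> {1..2 * n}" "cyc_suc n (f i) \<in> {1..2 * n}" using fin[OF i(1)] by auto
      fix j assume j: "j < u"
      show "n + g j \<notin> {f i, cyc_suc n (f i)}" using sep[OF i(1) j] by auto
      assume "j \<noteq> i"
      with i j have "\<not> cyc_near n (f i) (f j)" by blast
      then show "f j \<notin> {f i, cyc_suc n (f i)}" "cyc_suc n (f j) \<notin> {f i, cyc_suc n (f i)}"
        using cyc_suc_inj[OF fin(1)[OF j] fin(1)[OF i(1)]] by (auto simp: cyc_near_def)
    qed
    then show ?thesis by (simp add: index_term_def)
  next
    case 2
    then obtain i where i: "i < u" "\<And>j. j < u \<Longrightarrow> j \<noteq> i \<Longrightarrow> \<not> cyc_near n (g i) (g j)"
      by (auto simp: isolation_free_def)
    have "cross_avg (2 * n) u (\<lambda>i. n + g i) (\<lambda>i. n + cyc_suc n (g i)) (\<lambda>i. cyc_suc n (f i)) = 0"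
    proof (rule cross_avg_eq_0[OF i(1)])
      show "n + g i \<in> {1..2 * n}" "n + cyc_suc n (g i) \<in> {1..2 * n}" using gin[OF i(1)] by auto
      fix j assume j: "j < u"
      show "cyc_suc n (f j) \<notin> {n + g i, n + cyc_suc n (g i)}" using sep[OF j i(1)] by auto
      assume "j \<noteq> i"
      with i j have "\<not> cyc_near n (g i) (g j)" by blast
      then show "n + g j \<notin> {n + g i, n + cyc_suc n (g i)}" "n + cyc_suc n (g j) \<notin> {n + g i, n + cyc_suc n (g i)}"
        using cyc_suc_inj[OF gin(1)[OF j] gin(1)[OF i(1)]] by (auto simp: cyc_near_def)
    qed
    then show ?thesis by (simp add: index_term_def)
  qed
qed

text \<open>Within each half of \<open>{1..2 * n}\<close> the profiles decide which indices
  coincide, and indices from different halves never do. So \<open>cross_avg_kernel\<close> applies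
  to both averages, even across different \<open>n\<close>.\<close>

lemma index_term_profile:
  assumes f: "f \<in> index_fns n u" and g: "g \<in> index_fns n u"
    and f': "f' \<in> index_fns n' u" and g': "g' \<in> index_fns n' u"
    and pf: "profile n u f = profile n' u f'" and pg: "profile n u g = profile n' u g'"
  shows "index_term n u f g = index_term n' u f' g'"
proof -
  have rng: "1 \<le> h i" "h i \<le> m" "1 \<le> cyc_suc m (h i)" "cyc_suc m (h i) \<le> m"
    if "h \<in> index_fns m u" "i < u" for h m i
    using index_fns_in[OF that] cyc_suc_in[OF index_fns_in[OF that]] by auto
  have ker: "h i = h j \<longleftrightarrow> h' i = h' j" "cyc_suc m (h i) = cyc_suc m (h j) \<longleftrightarrow> cyc_suc m' (h' i) = cyc_suc m' (h' j)"
    "h i = cyc_suc m (h j) \<longleftrightarrow> h' i = cyc_suc m' (h' j)"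
    if h: "h \<in> index_fns m u" "h' \<in> index_fns m' u" and "profile m u h = profile m' u h'" "i < u" "j < u"
    for h m h' m' i j
  proof -
    show "h i = h j \<longleftrightarrow> h' i = h' j" "h i = cyc_suc m (h j) \<longleftrightarrow> h' i = cyc_suc m' (h' j)"
      using that(3-5) by (auto simp: profile_def set_eq_iff)
    then show "cyc_suc m (h i) = cyc_suc m (h j) \<longleftrightarrow> cyc_suc m' (h' i) = cyc_suc m' (h' j)"
      using cyc_suc_inj index_fns_in h that(4,5) by metis
  qed
  have sep: "f i \<noteq> n + g j" "cyc_suc n (f i) \<noteq> n + g j" "cyc_suc n (f i) \<noteq> n + cyc_suc n (g j)"
    "f' i \<noteq> n' + g' j" "cyc_suc n' (f' i) \<noteq> n' + g' j" "cyc_suc n' (f' i) \<noteq> n' + cyc_suc n' (g' j)"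
    if "i < u" "j < u" for i j
    using rng[OF f that(1)] rng[OF g that(2)] rng[OF f' that(1)] rng[OF g' that(2)] by linarith+
  have img: "f i \<in> {1..2 * n}" "cyc_suc n (f i) \<in> {1..2 * n}" "n + g i \<in> {1..2 * n}" "n + cyc_suc n (g i) \<in> {1..2 * n}"
    "f' i \<in> {1..2 * n'}" "cyc_suc n' (f' i) \<in> {1..2 * n'}" "n' + g' i \<in> {1..2 * n'}" "n' + cyc_suc n' (g' i) \<in> {1..2 * n'}"
    if "i < u" for i
    using rng[OF f that] rng[OF g that] rng[OF f' that] rng[OF g' that] by auto
  have "cross_avg (2 * n) u f (\<lambda>i. cyc_suc n (f i)) (\<lambda>i. n + g i) =
      cross_avg (2 * n') u f' (\<lambda>i. cyc_suc n' (f' i)) (\<lambda>i. n' + g' i)"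
  proof (rule cross_avg_kernel)
    fix i j assume ij: "i < u" "j < u"
    show "(f i = f j \<longleftrightarrow> f' i = f' j) \<and> (cyc_suc n (f i) = cyc_suc n (f j) \<longleftrightarrow> cyc_suc n' (f' i) = cyc_suc n' (f' j)) \<and>
      (n + g i = n + g j \<longleftrightarrow> n' + g' i = n' + g' j) \<and> (f i = cyc_suc n (f j) \<longleftrightarrow> f' i = cyc_suc n' (f' j)) \<and>
      (f i = n + g j \<longleftrightarrow> f' i = n' + g' j) \<and> (cyc_suc n (f i) = n + g j \<longleftrightarrow> cyc_suc n' (f' i) = n' + g' j)"
      using ker[OF f f' pf ij] ker(1)[OF g g' pg ij] sep[OF ij] by simp
  qed (use img in blast)+
  moreover have "cross_avg (2 * n) u (\<lambda>i. n + g i) (\<lambda>i. n + cyc_suc n (g i)) (\<lambda>i. cyc_suc n (f i)) =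
      cross_avg (2 * n') u (\<lambda>i. n' + g' i) (\<lambda>i. n' + cyc_suc n' (g' i)) (\<lambda>i. cyc_suc n' (f' i))"
  proof (rule cross_avg_kernel)
    fix i j assume ij: "i < u" "j < u"
    show "(n + g i = n + g j \<longleftrightarrow> n' + g' i = n' + g' j) \<and>
      (n + cyc_suc n (g i) = n + cyc_suc n (g j) \<longleftrightarrow> n' + cyc_suc n' (g' i) = n' + cyc_suc n' (g' j)) \<and>
      (cyc_suc n (f i) = cyc_suc n (f j) \<longleftrightarrow> cyc_suc n' (f' i) = cyc_suc n' (f' j)) \<and>
      (n + g i = n + cyc_suc n (g j) \<longleftrightarrow> n' + g' i = n' + cyc_suc n' (g' j)) \<and>
      (n + g i = cyc_suc n (f j) \<longleftrightarrow> n' + g' i = cyc_suc n' (f' j)) \<and>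
      (n + cyc_suc n (g i) = cyc_suc n (f j) \<longleftrightarrow> n' + cyc_suc n' (g' i) = cyc_suc n' (f' j))"
      using ker[OF g g' pg ij] ker(2)[OF f f' pf ij] sep[OF ij(2,1)] not_sym by simp
  qed (use img in blast)+
  ultimately show ?thesis by (simp add: index_term_def)
qed

section \<open>Growth and convergence of the moments\<close>

text \<open>Only pairs of isolation-free tuples contribute, each at most 1 in absolute value. The
  number of pairs is the square bounded in \<open>card_isolation_free_le\<close>, and
  \<open>real n ^ u\<close> cancels.\<close>

lemma moment_bound:
  assumes n: "n \<ge> u" "n > 0"
  shows "\<bar>measure_pmf.expectation (random_grid_pair n) (\<lambda>p. normalized_lk n p ^ u)\<bar> \<le> 36 ^ u * real u ^ u"
proof -
  let ?I = "index_fns n u" and ?A = "{f \<in> index_fns n u. isolation_free n u f}"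
  have eq: "(\<Sum>f\<in>?I. \<Sum>g\<in>?I. index_term n u f g) = (\<Sum>f\<in>?A. \<Sum>g\<in>?A. index_term n u f g)"
  proof -
    have "(\<Sum>g\<in>?I. index_term n u f g) = (\<Sum>g\<in>?A. index_term n u f g)" if "f \<in> ?I" for f
      by (rule sum.mono_neutral_right) (use that index_term_eq_0 in auto)
    moreover have "(\<Sum>f\<in>?I. \<Sum>g\<in>?A. index_term n u f g) = (\<Sum>f\<in>?A. \<Sum>g\<in>?A. index_term n u f g)"
      by (rule sum.mono_neutral_right) (auto intro!: sum.neutral index_term_eq_0)
    ultimately show ?thesis by simp
  qed
  have "\<bar>\<Sum>f\<in>?A. \<Sum>g\<in>?A. index_term n u f g\<bar> \<le> (\<Sum>f\<in>?A. \<Sum>g\<in>?A. \<bar>index_term n u f g\<bar>)"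
    by (intro order_trans[OF sum_abs] sum_mono sum_abs)
  also have "\<dots> \<le> (\<Sum>f\<in>?A. \<Sum>g\<in>?A. 1)" by (intro sum_mono abs_index_term_le)
  also have "\<dots> = (real (card ?A))\<^sup>2" by (simp add: power2_eq_square)
  also have "\<dots> \<le> 36 ^ u * real u ^ u * real n ^ u" by (rule card_isolation_free_le[OF n(1)])
  finally show ?thesis
    using n(2) unfolding moment_expansion eq by (simp add: abs_mult power_abs divide_le_eq)
qed

text \<open>Group the terms by pairs of profiles: a finite sum, the same for all \<open>n\<close>,
  with constant weights. Writing \<open>real n ^ u\<close> as a product of two equal powers of
  \<open>sqrt (real n)\<close> normalizes each of the two counts.\<close>

lemma moment_convergent:
  "convergent (\<lambda>n. measure_pmf.expectation (random_grid_pair n) (\<lambda>p. normalized_lk n p ^ u))"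
proof -
  define Q where "Q = Pow ({..<u} \<times> {..<u}) \<times> Pow ({..<u} \<times> {..<u})"
  have finQ: "finite Q" by (simp add: Q_def)
  have profile_Q: "profile n u ` index_fns n u \<subseteq> Q" for n
    by (auto simp: Q_def profile_def)
  \<comment> \<open>The common value of all terms with these profiles. It is set to 0 in the
    presence of an isolated index, where the terms vanish although the counts may be too large to
    normalize. For a pair never realized together the value is arbitrary, but then for every
    \<open>n\<close> one of the counts is 0.\<close>
  define W where "W D E = (if profile_isolation_free u D \<and> profile_isolation_free u E then
      SOME w. \<exists>n. \<exists>f\<in>index_fns n u. \<exists>g\<in>index_fns n u.
        profile n u f = D \<and> profile n u g = E \<and> w = index_term n u f g else 0)" for D E
  have W: "index_term n u f g = W (profile n u f) (profile n u g)"
    if f: "f \<in> index_fns n u" and g: "g \<in> index_fns n u" for n f g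
  proof (cases "isolation_free n u f \<and> isolation_free n u g")
    case False
    then show ?thesis using index_term_eq_0[OF f g] by (auto simp: W_def isolation_free_profile)
  next
    case True
    have "(SOME w. \<exists>m. \<exists>f'\<in>index_fns m u. \<exists>g'\<in>index_fns m u.
        profile m u f' = profile n u f \<and> profile m u g' = profile n u g \<and> w = index_term m u f' g') =
        index_term n u f g"
    proof (rule some_equality)
      show "\<exists>m. \<exists>f'\<in>index_fns m u. \<exists>g'\<in>index_fns m u.
        profile m u f' = profile n u f \<and> profile m u g' = profile n u g \<and> index_term n u f g = index_term m u f' g'"
        using f g by blast
    qed (use index_term_profile f g in blast)
    then show ?thesis using True by (simp add: W_def isolation_free_profile)
  qed
  have group: "(\<Sum>f\<in>index_fns n u. h (profile n u f)) = (\<Sum>D\<in>Q. real (profile_count n u D) * h D)" for n and h :: "_ \<Rightarrow> real"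
    unfolding profile_count_def by (rule sum_fun_comp[OF finite_index_fns finQ profile_Q])
  have "measure_pmf.expectation (random_grid_pair n) (\<lambda>p. normalized_lk n p ^ u) =
      (- 1) ^ u * (\<Sum>D\<in>Q. \<Sum>E\<in>Q. W D E *
        (real (profile_count n u D) / sqrt (real n) ^ u) * (real (profile_count n u E) / sqrt (real n) ^ u))" for n
  proof -
    have sq: "real n ^ u = sqrt (real n) ^ u * sqrt (real n) ^ u"
      by (simp flip: power_mult_distrib)
    have "(\<Sum>f\<in>index_fns n u. \<Sum>g\<in>index_fns n u. index_term n u f g) =
        (\<Sum>f\<in>index_fns n u. \<Sum>g\<in>index_fns n u. W (profile n u f) (profile n u g))"
      by (intro sum.cong refl W)
    also have "\<dots> = (\<Sum>D\<in>Q. real (profile_count n u D) * (\<Sum>E\<in>Q. real (profile_count n u E) * W D E))"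
      unfolding group by (rule group)
    finally show ?thesis
      unfolding moment_expansion sq
      by (simp add: sum_distrib_left sum_divide_distrib mult_ac)
  qed
  then have expansion: "(\<lambda>n. measure_pmf.expectation (random_grid_pair n) (\<lambda>p. normalized_lk n p ^ u)) =
      (\<lambda>n. (- 1) ^ u * (\<Sum>D\<in>Q. \<Sum>E\<in>Q. W D E *
        (real (profile_count n u D) / sqrt (real n) ^ u) * (real (profile_count n u E) / sqrt (real n) ^ u)))"
    by (rule ext)
  have "convergent (\<lambda>n. W D E * (real (profile_count n u D) / sqrt (real n) ^ u) *
      (real (profile_count n u E) / sqrt (real n) ^ u))" for D E
  proof (cases "profile_isolation_free u D \<and> profile_isolation_free u E")
    case True
    then show ?thesis by (intro convergent_mult convergent_const profile_count_convergent) auto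
  next
    case False
    then have "W D E = 0" by (auto simp: W_def)
    then show ?thesis by (simp add: convergent_const)
  qed
  then show ?thesis
    unfolding expansion by (intro convergent_mult[OF convergent_const] convergent_sum)
qed

text \<open>\<open>real u ^ u / fact u\<close> is one term of the exponential series at
  \<open>u\<close>, and \<open>exp 1 \<le> 3\<close>.\<close>

lemma power_self_le_fact: "real u ^ u \<le> 3 ^ u * fact u"
proof -
  have "(\<Sum>k\<in>{u}. real u ^ k /\<^sub>R fact k) \<le> (\<Sum>k. real u ^ k /\<^sub>R fact k)"
    by (rule sum_le_suminf[OF summable_exp_generic]) auto
  then have "real u ^ u / fact u \<le> exp (real u)"
    by (simp add: exp_def divide_inverse mult.commute)
  also have "\<dots> = exp 1 ^ u" by (simp flip: exp_of_nat_mult)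
  also have "\<dots> \<le> 3 ^ u" using exp_le by (intro power_mono) auto
  finally show ?thesis by (simp add: field_simps)
qed

theorem corollary1p2:
  shows "\<exists>\<mu> :: nat \<Rightarrow> real.
    (\<forall>u\<ge>1. (\<lambda>n. measure_pmf.expectation (random_grid_pair n) (\<lambda>p. normalized_lk n p ^ u)) \<longlonglongrightarrow> \<mu> u) \<and>
    (\<exists>!M. real_distribution M \<and> has_moments M \<mu>) \<and>
    (\<forall>M. real_distribution M \<and> has_moments M \<mu> \<longrightarrow>
       weak_conv_m (\<lambda>n. distr (measure_pmf (random_grid_pair n)) borel (normalized_lk n)) M)"
proof -
  define m where "m u = lim (\<lambda>n. measure_pmf.expectation (random_grid_pair n) (\<lambda>p. normalized_lk n p ^ u))" for u
  define \<nu> where "\<nu> n = distr (measure_pmf (random_grid_pair n)) borel (normalized_lk n)" for n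
  have lim: "(\<lambda>n. measure_pmf.expectation (random_grid_pair n) (\<lambda>p. normalized_lk n p ^ u)) \<longlonglongrightarrow> m u" for u
    using moment_convergent unfolding m_def by (simp add: convergent_LIMSEQ_iff)
  have \<nu>: "real_distribution (\<nu> n)" for n
    unfolding \<nu>_def by (rule prob_space.real_distribution_distr[OF measure_pmf.prob_space_axioms]) simp
  have int: "integrable (\<nu> n) (\<lambda>x. x ^ k)" for n k
    unfolding \<nu>_def
    by (subst integrable_distr_eq) (auto intro!: integrable_measure_pmf_finite finite_set_pmf_random_grid_pair)
  have moment: "(\<integral>x. x ^ k \<partial>\<nu> n) = measure_pmf.expectation (random_grid_pair n) (\<lambda>p. normalized_lk n p ^ k)" for n k
    unfolding \<nu>_def by (subst integral_distr) auto
  \<comment> \<open>Here \<open>108 = 36 * 3\<close>, where the 3 is the price for replacing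
    \<open>real u ^ u\<close> by a factorial.\<close>
  have bound: "m u \<le> 108 ^ u * fact u" for u
  proof (rule LIMSEQ_le_const2[OF lim])
    have "36 ^ u * real u ^ u \<le> 36 ^ u * (3 ^ u * fact u)"
      by (intro mult_left_mono power_self_le_fact) simp
    also have "\<dots> = 108 ^ u * fact u"
      by (simp add: mult.assoc[symmetric] power_mult_distrib[symmetric])
    finally have "36 ^ u * real u ^ u \<le> 108 ^ u * fact u" .
    \<comment> \<open>The witness \<open>Suc u\<close> secures both \<open>n \<ge> u\<close> and
      \<open>n > 0\<close>.\<close>
    then show "\<exists>N. \<forall>n\<ge>N. measure_pmf.expectation (random_grid_pair n) (\<lambda>p. normalized_lk n p ^ u) \<le> 108 ^ u * fact u"
      using moment_bound[of u] by (intro exI[of _ "Suc u"]) (smt (verit) Suc_le_eq le_eq_less_or_eq zero_less_Suc less_le_trans)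
  qed
  \<comment> \<open>\<open>has_moments\<close> starts at order 1, while the method of moments
    includes order 0; the gap is filled by the total mass 1.\<close>
  have m0: "m 0 = 1" using lim[of 0] by (simp add: LIMSEQ_const_iff)
  have has: "real_distribution M \<and> has_moments M m \<longleftrightarrow>
      real_distribution M \<and> (\<forall>k. has_bochner_integral M (\<lambda>x. x ^ k) (m k))" for M
  proof -
    have "has_bochner_integral M (\<lambda>x. x ^ 0) (m 0)" if "real_distribution M"
    proof -
      interpret real_distribution M by fact
      show ?thesis using m0 prob_space by (simp add: has_bochner_integral_iff)
    qed
    then show ?thesis unfolding has_moments_def by (metis less_one not_less)
  qed
  have lim_\<nu>: "(\<lambda>n. \<integral>x. x ^ k \<partial>\<nu> n) \<longlonglongrightarrow> m k" for k
    unfolding moment by (rule lim)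
  note limit = method_of_moments[OF \<nu> int lim_\<nu> bound]
  have "\<exists>!M. real_distribution M \<and> has_moments M m"
    unfolding has by (rule limit(1)) simp
  moreover have "weak_conv_m \<nu> M" if "real_distribution M \<and> has_moments M m" for M
    using that unfolding has by (intro limit(2)) auto
  ultimately show ?thesis using lim unfolding \<nu>_def by blast
qed

end
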